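(* Let $G=(V,E,w)$ be an $n$-vertex weighted undirected graph (with arbitrary aspect ratio), and let $k,h\in[n]=\{1,\dots,n\}$. Then there is a distribution $\mathcal{D}$ over clan embeddings $(f,\chi)$ of $G$ into ultrametrics with hop-distortion $\left(O(k\cdot\log\log n),O(k\cdot\log\log n),h\right)$ and hop-path-distortion $\left(O(k\cdot\log n\cdot\log\log n),h\right)$, such that for every $v\in V$, $\mathbb{E}_{(f,\chi)\sim\mathcal{D}}[|f(v)|]\le O(n^{1/k})$. In addition, for every $\epsilon\in(0,1)$, there is a distribution $\mathcal{D}$ over clan embeddings of $G$ into ultrametrics such that every clan embedding in the support has hop-distortion $\left(O(\frac{\log n\cdot\log\log n}{\epsilon}),O(\frac{\log n\cdot\log\log n}{\epsilon}),h\right)$ and hop-path-distortion $\left(O(\frac{\log^2 n\cdot\log\log n}{\epsilon}),h\right)$, and such that for every $v\in V$, $\mathbb{E}_{(f,\chi)\sim\mathcal{D}}[|f(v)|]\le1+\epsilon$.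
   Context: Graphs are undirected with finite positive edge weights. For $h\in\mathbb{N}$, $d_G^{(h)}(u,v)$ is the minimum weight of a $u$-$v$ path in $G$ with at most $h$ edges (hops), and is $\infty$ if no such path exists. Constants hidden in $O(\cdot)$ are universal, and (iterated) logarithmic factors inside $O(\cdot)$ are understood to be at least $1$. An ultrametric is a metric space with $d(x,z)\le\max\{d(x,y),d(y,z)\}$ for all $x,y,z$; the value $\infty$ is allowed as a distance. A one-to-many embedding of $V$ into a metric space $Y$ is a map $f:V\to2^Y$ sending each vertex to a non-empty set (its copies), with the sets $\{f(v)\}_{v\in V}$ pairwise disjoint. It is dominating if $d_G(u,v)\le\min_{u'\in f(u),v'\in f(v)}d_Y(u',v')$ for all $u,v$. A clan embedding is a pair $(f,\chi)$ where $f$ is a dominating one-to-many embedding and $\chi:V\to Y$ satisfies $\chi(v)\in f(v)$ for all $v$ (the chief of $v$). $(f,\chi)$ has hop-distortion $(t,\beta,h)$ if for all $u,v\in V$: $d_G^{(\beta\cdot h)}(u,v)\le\min_{v'\in f(v),u'\in f(u)}d_Y(v',u')$ and $\min_{v'\in f(v)}d_Y(v',\chi(u))\le t\cdot d_G^{(h)}(u,v)$. A subgraph $H$ of $G$ is $h$-respecting if $d_G^{(h)}(u,v)\le d_H(u,v)$ for all $u,v\in V(H)$, where $d_H$ is the shortest path distance in $H$. A (not necessarily simple) path $P=(v_0,\dots,v_m)$ in $G$ is $h$-respecting if the subgraph of $G$ consisting of the vertices and edges of $P$ is $h$-respecting. $f$ has hop-path-distortion $(t,h)$ if for every $h$-respecting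 path $P=(v_0,\dots,v_m)$ there are $v_i'\in f(v_i)$ such that $\sum_{i=0}^{m-1}d_Y(v_i',v_{i+1}')\le t\cdot\sum_{i=0}^{m-1}w(v_i,v_{i+1})$. *)

theory Defs
  imports "HOL-Probability.Probability" "Graph_Theory.Graph_Theory"
begin

section \<open>Weighted graphs and hop-constrained distances\<close>

text \<open>
  A finite simple undirected graph is a symmetric loop-free digraph; the two orientations of an
  edge carry the same weight.
\<close>

locale weighted_graph = pair_graph G
  for G :: "'a pair_pre_digraph" +
  fixes w :: "('a \<times> 'a) weight_fun"
  assumes weight_pos: "e \<in> parcs G \<Longrightarrow> 0 < w e"
    and weight_sym: "(u, v) \<in> parcs G \<Longrightarrow> w (u, v) = w (v, u)"

abbreviation graph_dist :: "'a pair_pre_digraph \<Rightarrow> ('a \<times> 'a) weight_fun \<Rightarrow> 'a \<Rightarrow> 'a \<Rightarrow> ereal" where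
  "graph_dist G w u v \<equiv> wf_digraph.\<mu> (with_proj G) w u v"

text \<open>
  As in the library's \<open>\<mu>\<close>, the infimum ranges over walks, so it is \<open>\<infinity>\<close> if there is none. It is a
  minimum, and attained by a simple path: there are finitely many walks with at most \<open>h\<close> arcs, and
  deleting cycles decreases both weight and number of hops.
\<close>

definition hop_dist ::
  "'a pair_pre_digraph \<Rightarrow> ('a \<times> 'a) weight_fun \<Rightarrow> nat \<Rightarrow> 'a \<Rightarrow> 'a \<Rightarrow> ereal" where
  "hop_dist G w h u v =
    (INF p \<in> {p. pre_digraph.awalk (with_proj G) u p v \<and> length p \<le> h}.
      ereal (wf_digraph.awalk_cost w p))"

definition hop_respecting ::
  "'a pair_pre_digraph \<Rightarrow> ('a \<times> 'a) weight_fun \<Rightarrow> nat \<Rightarrow> 'a pair_pre_digraph \<Rightarrow> bool" where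
  "hop_respecting G w h H \<longleftrightarrow>
    subgraph (with_proj H) (with_proj G) \<and>
    (\<forall>u\<in>pverts H. \<forall>v\<in>pverts H. hop_dist G w h u v \<le> graph_dist H w u v)"

definition walk_subgraph :: "'a \<Rightarrow> ('a \<times> 'a) awalk \<Rightarrow> 'a pair_pre_digraph" where
  "walk_subgraph u p = \<lparr> pverts = set (pawalk_verts u p), parcs = set p \<union> (set p)\<inverse> \<rparr>"

section \<open>Clan embeddings into ultrametrics\<close>

definition ultrametric_on :: "'p set \<Rightarrow> ('p \<Rightarrow> 'p \<Rightarrow> ereal) \<Rightarrow> bool" where
  "ultrametric_on Y d \<longleftrightarrow>
    (\<forall>x\<in>Y. \<forall>y\<in>Y. 0 \<le> d x y \<and> (d x y = 0 \<longleftrightarrow> x = y) \<and> d x y = d y x) \<and>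
    (\<forall>x\<in>Y. \<forall>y\<in>Y. \<forall>z\<in>Y. d x z \<le> max (d x y) (d y z))"

text \<open>The target space is part of the data, since it varies over a distribution of embeddings.\<close>

record ('a, 'p) clan =
  points :: "'p set"
  pdist :: "'p \<Rightarrow> 'p \<Rightarrow> ereal"
  copies :: "'a \<Rightarrow> 'p set"
  chief :: "'a \<Rightarrow> 'p"

definition ultrametric_clan_embedding ::
  "'a pair_pre_digraph \<Rightarrow> ('a \<times> 'a) weight_fun \<Rightarrow> ('a, 'p) clan \<Rightarrow> bool" where
  "ultrametric_clan_embedding G w c \<longleftrightarrow>
    ultrametric_on (points c) (pdist c) \<and>
    (\<forall>v\<in>pverts G. copies c v \<noteq> {} \<and> copies c v \<subseteq> points c) \<and>
    disjoint_family_on (copies c) (pverts G) \<and>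
    (\<forall>u\<in>pverts G. \<forall>v\<in>pverts G.
      graph_dist G w u v \<le> (INF u' \<in> copies c u. INF v' \<in> copies c v. pdist c u' v')) \<and>
    (\<forall>v\<in>pverts G. chief c v \<in> copies c v)"

text \<open>
  The hop bound \<open>\<beta> h\<close> need not be an integer; a walk has at most \<open>\<beta> h\<close> arcs iff it has at most
  \<open>\<lfloor>\<beta> h\<rfloor>\<close> arcs.
\<close>

definition hop_distortion ::
  "'a pair_pre_digraph \<Rightarrow> ('a \<times> 'a) weight_fun \<Rightarrow> real \<Rightarrow> real \<Rightarrow> nat \<Rightarrow> ('a, 'p) clan \<Rightarrow> bool" where
  "hop_distortion G w t \<beta> h c \<longleftrightarrow>
    (\<forall>u\<in>pverts G. \<forall>v\<in>pverts G.
      hop_dist G w (nat \<lfloor>\<beta> * real h\<rfloor>) u v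
        \<le> (INF v' \<in> copies c v. INF u' \<in> copies c u. pdist c v' u') \<and>
      (INF v' \<in> copies c v. pdist c v' (chief c u)) \<le> ereal t * hop_dist G w h u v)"

definition hop_path_distortion ::
  "'a pair_pre_digraph \<Rightarrow> ('a \<times> 'a) weight_fun \<Rightarrow> real \<Rightarrow> nat \<Rightarrow> ('a, 'p) clan \<Rightarrow> bool" where
  "hop_path_distortion G w t h c \<longleftrightarrow>
    (\<forall>u p v. pre_digraph.awalk (with_proj G) u p v \<and> hop_respecting G w h (walk_subgraph u p) \<longrightarrow>
      (\<exists>s :: nat \<Rightarrow> 'p.
        (\<forall>i\<le>length p. s i \<in> copies c (pawalk_verts u p ! i)) \<and>
        (\<Sum>i<length p. pdist c (s i) (s (Suc i))) \<le> ereal (t * wf_digraph.awalk_cost w p)))"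

text \<open>
  The counting measure gives an infinite set of copies size \<open>\<infinity>\<close>, whereas \<^const>\<open>card\<close> would give
  it size 0.
\<close>

definition expected_copies :: "('a, 'p) clan pmf \<Rightarrow> 'a \<Rightarrow> ennreal" where
  "expected_copies D v =
    (\<integral>\<^sup>+ c. emeasure (count_space UNIV) (copies c v) \<partial>measure_pmf D)"

section \<open>Logarithmic factors, truncated below at 1\<close>

definition log_factor :: "nat \<Rightarrow> real" where
  "log_factor n = max 1 (ln (real n))"

definition loglog_factor :: "nat \<Rightarrow> real" where
  "loglog_factor n = max 1 (ln (ln (real n)))"

end

theory Submission
  imports Defs
begin

text \<open>
  Fix vertex weights \<open>\<mu> \<ge> 1\<close>. A cluster whose \<open>4Lh\<close>-hop diameter is at most \<open>s\<close> is decomposed at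
  scale \<open>s / 2 = 4L\<Delta>\<close>. If every ball with \<open>2L\<close> steps, each of \<open>h\<close> hops and length \<open>\<Delta>\<close>, holds more
  than half of the mass, any two balls meet and the cluster already has the smaller diameter.
  Otherwise, with \<open>L = O(k log log n)\<close>, some ball \<open>A\<close> is hardly lighter than the ball \<open>A'\<close> two steps
  further out; \<open>A'\<close> becomes a cluster of the smaller scale, and the decomposition continues on the
  complement of \<open>A\<close>. Vertices in \<open>A' - A\<close> are duplicated, and the growth condition keeps the total
  weight of all copies below \<open>\<mu>(V) powr (1 + 1/k)\<close> over all scales. The chief is placed according to
  the ball in between, so that a vertex within \<open>h\<close> hops and distance \<open>\<Delta>\<close> has a copy on the same side.

  A path is cut so that the parts leading from \<open>A\<close> to the outside of \<open>A'\<close>, which pay for the cuts,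
  go to \<open>A'\<close>. As \<open>A'\<close> has at most half of the mass, an edge pays at most \<open>log \<mu>(V)\<close> times.

  The multiplicative weights method turns the embeddings for all \<open>\<mu>\<close> into one distribution.
\<close>

section \<open>Hop-constrained distances and traced paths\<close>

text \<open>Only these properties of hop distances enter the construction. Hop bounds add up along
  with lengths, so a fixed bound gives no triangle inequality.\<close>

locale hop_metric =
  fixes V :: "'a set" and D :: "nat \<Rightarrow> 'a \<Rightarrow> 'a \<Rightarrow> ereal"
  assumes finite_V: "finite V"
    and D_refl: "u \<in> V \<Longrightarrow> D h u u = 0"
    and D_pos: "u \<in> V \<Longrightarrow> v \<in> V \<Longrightarrow> u \<noteq> v \<Longrightarrow> 0 < D h u v"
    and D_sym: "u \<in> V \<Longrightarrow> v \<in> V \<Longrightarrow> D h u v = D h v u"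
    and D_triangle: "u \<in> V \<Longrightarrow> v \<in> V \<Longrightarrow> z \<in> V \<Longrightarrow> D (a + b) u z \<le> D a u v + D b v z"
    and D_antimono: "a \<le> b \<Longrightarrow> D b u v \<le> D a u v"
begin

lemma D_nonneg: "u \<in> V \<Longrightarrow> v \<in> V \<Longrightarrow> 0 \<le> D h u v"
  using D_refl[of u h] D_pos[of u v h] by (cases "u = v") auto

lemma D_triangle_le:
  assumes "u \<in> V" "v \<in> V" "z \<in> V" "D a u v \<le> ereal r" "D b v z \<le> ereal r'" "a + b \<le> c" "r + r' \<le> q"
  shows "D c u z \<le> ereal q"
proof -
  have "D c u z \<le> D (a + b) u z" using assms by (intro D_antimono) auto
  also have "\<dots> \<le> D a u v + D b v z" using assms by (intro D_triangle)
  also have "\<dots> \<le> ereal r + ereal r'" using assms by (intro add_mono)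
  also have "\<dots> \<le> ereal q" using assms by simp
  finally show ?thesis .
qed

text \<open>The form in which an h-respecting path is used: every stretch, however many edges it
  has, is at least as long as the \<open>h\<close>-hop distance of its ends. \<open>w i\<close>
  stands for the weight of the edge from \<open>x i\<close> to \<open>x (Suc i)\<close>.\<close>

definition hop_path :: "nat \<Rightarrow> (nat \<Rightarrow> 'a) \<Rightarrow> (nat \<Rightarrow> real) \<Rightarrow> nat \<Rightarrow> nat \<Rightarrow> bool" where
  "hop_path h x w a b \<longleftrightarrow>
    (\<forall>i j. a \<le> i \<longrightarrow> i \<le> j \<longrightarrow> j \<le> b \<longrightarrow> D h (x i) (x j) \<le> ereal (sum w {i..<j}))"

lemma hop_path_subpath: "hop_path h x w a b \<Longrightarrow> a \<le> a' \<Longrightarrow> b' \<le> b \<Longrightarrow> hop_path h x w a' b'"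
  unfolding hop_path_def by fastforce

text \<open>Each weight bounds the hop distance of two consecutive vertices, which is
  nonnegative.\<close>

lemma hop_path_sum_nonneg:
  assumes "hop_path h x w a b" "x ` {a..b} \<subseteq> V" "a \<le> i" "j \<le> b"
  shows "0 \<le> sum w {i..<j}"
proof (rule sum_nonneg)
  fix l assume "l \<in> {i..<j}"
  then have l: "a \<le> l" "l < b" using assms by auto
  then have "0 \<le> D h (x l) (x (Suc l))" using assms(2) by (intro D_nonneg) auto
  also have "\<dots> \<le> ereal (sum w {l..<Suc l})"
    using assms(1) l unfolding hop_path_def by (metis Suc_leI le_SucI order_refl)
  finally show "0 \<le> w l" by simp
qed

end

section \<open>Copies chosen along a path\<close>

definition traced :: "('a, 'p) clan \<Rightarrow> (nat \<Rightarrow> 'a) \<Rightarrow> nat \<Rightarrow> nat \<Rightarrow> real \<Rightarrow> bool" where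
  "traced c x a b r \<longleftrightarrow> (\<exists>s. (\<forall>i\<in>{a..b}. s i \<in> copies c (x i)) \<and>
     (\<Sum>i\<in>{a..<b}. pdist c (s i) (s (Suc i))) \<le> ereal r)"

lemma traced_mono: "traced c x a b r \<Longrightarrow> r \<le> r' \<Longrightarrow> traced c x a b r'"
  unfolding traced_def by (meson ereal_less_eq(3) order_trans)

text \<open>Copies are chosen per position, not per vertex, so the two choices can be spliced; as
  \<open>r\<close> bounds the distance of every pair of copies at the joint, they need no
  coordination.\<close>

lemma traced_join:
  assumes 1: "traced c x a b r1" and 2: "traced c x (Suc b) e r2" and ab: "a \<le> b" "b < e"
    and s: "\<And>p q. p \<in> copies c (x b) \<Longrightarrow> q \<in> copies c (x (Suc b)) \<Longrightarrow> pdist c p q \<le> ereal r"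
  shows "traced c x a e (r1 + r + r2)"
proof -
  obtain s1 s2 where s1: "\<forall>i\<in>{a..b}. s1 i \<in> copies c (x i)"
      "(\<Sum>i\<in>{a..<b}. pdist c (s1 i) (s1 (Suc i))) \<le> ereal r1"
    and s2: "\<forall>i\<in>{Suc b..e}. s2 i \<in> copies c (x i)"
      "(\<Sum>i\<in>{Suc b..<e}. pdist c (s2 i) (s2 (Suc i))) \<le> ereal r2"
    using 1 2 unfolding traced_def by blast
  define s where "s i = (if i \<le> b then s1 i else s2 i)" for i
  let ?f = "\<lambda>i. pdist c (s i) (s (Suc i))"
  have "sum ?f {a..<e} = sum ?f {a..<b} + (?f b + sum ?f {Suc b..<e})"
    using ab sum.atLeastLessThan_concat[of a b e ?f] sum.atLeast_Suc_lessThan[of b e ?f] by simp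
  also have "sum ?f {a..<b} = (\<Sum>i\<in>{a..<b}. pdist c (s1 i) (s1 (Suc i)))"
    by (intro sum.cong) (auto simp: s_def)
  also have "sum ?f {Suc b..<e} = (\<Sum>i\<in>{Suc b..<e}. pdist c (s2 i) (s2 (Suc i)))"
    by (intro sum.cong) (auto simp: s_def)
  also have "?f b \<le> ereal r" using s1 s2 ab by (intro s) (auto simp: s_def)
  finally have "sum ?f {a..<e} \<le> ereal r1 + (ereal r + ereal r2)"
    using s1(2) s2(2) by (meson add_mono order_refl order_trans add_left_mono add_right_mono)
  moreover have "\<forall>i\<in>{a..e}. s i \<in> copies c (x i)" using s1 s2 by (auto simp: s_def)
  ultimately show ?thesis unfolding traced_def by (intro exI[of _ s]) (auto simp: add.assoc)
qed

text \<open>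
  A path is cut around its maximal runs inside \<open>A'\<close> that meet \<open>A\<close>. Each cut is paid for by the
  part of the run that leads from \<open>A\<close> to the outside of \<open>A'\<close>; edges inside such a run have their
  coefficient reduced from \<open>l\<close> to \<open>l - t\<close>, which leaves room for this payment.
\<close>

lemma traced_cut:
  fixes w :: "nat \<Rightarrow> real" and t l :: real
  assumes inner: "\<And>a b. a \<le> b \<Longrightarrow> b \<le> m \<Longrightarrow> x ` {a..b} \<subseteq> A' \<Longrightarrow> traced c x a b ((l - t) * sum w {a..<b})"
    and outer: "\<And>a b. a \<le> b \<Longrightarrow> b \<le> m \<Longrightarrow> x ` {a..b} \<inter> A = {} \<Longrightarrow> traced c x a b (l * sum w {a..<b})"
    and cut: "\<And>f z p q i. f \<le> m \<Longrightarrow> z \<le> m \<Longrightarrow> x f \<in> A \<Longrightarrow> x z \<notin> A' \<Longrightarrow> i < m \<Longrightarrow>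
       p \<in> copies c (x i) \<Longrightarrow> q \<in> copies c (x (Suc i)) \<Longrightarrow>
       pdist c p q \<le> ereal (t * sum w {min f z..<max f z})"
    and AA': "A \<subseteq> A'"
    and w: "\<And>i. i < m \<Longrightarrow> 0 \<le> w i" and t: "0 \<le> t" "t \<le> l"
  shows "b \<le> m \<Longrightarrow> a \<le> b \<Longrightarrow> traced c x a b (l * sum w {a..<b})"
proof (induction "b - a" arbitrary: a rule: less_induct)
  case less
  have split: "sum w {i..<k} = sum w {i..<j} + sum w {j..<k}" if "i \<le> j" "j \<le> k" for i j k
    using that by (simp add: sum.atLeastLessThan_concat)
  have nn: "0 \<le> sum w {i..<j}" if "j \<le> b" for i j
    using that less.prems w by (intro sum_nonneg) auto
  \<comment> \<open>The run is extended to its last position \<open>e\<close> inside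
    \<open>A'\<close> and saves \<open>t\<close> on each of its edges. The saving after
    \<open>f\<close> pays for the cut behind the run; that on \<open>a'..<f\<close> stays in reserve
    for a cut in front of it.\<close>
  have run: "traced c x a' b (l * sum w {a'..<b} - t * sum w {a'..<f})"
    if a': "a \<le> a'" "a' \<le> f" "f \<le> b" "x f \<in> A" "x ` {a'..f} \<subseteq> A'" for a' f
  proof -
    define e where "e = Max {e. f \<le> e \<and> e \<le> b \<and> x ` {a'..e} \<subseteq> A'}"
    have "e \<in> {e. f \<le> e \<and> e \<le> b \<and> x ` {a'..e} \<subseteq> A'}"
      unfolding e_def by (rule Max_in) (use a' in \<open>auto intro: finite_subset[of _ "{..b}"]\<close>)
    then have e: "f \<le> e" "e \<le> b" "x ` {a'..e} \<subseteq> A'" by auto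
    have Te: "traced c x a' e ((l - t) * sum w {a'..<e})" using inner[of a' e] e a' less.prems by auto
    show ?thesis
    proof (cases "e = b")
      case True
      have "sum w {a'..<f} \<le> sum w {a'..<b}" using split[of a' f b] nn[of b f] a' by simp
      then have "(l - t) * sum w {a'..<b} \<le> l * sum w {a'..<b} - t * sum w {a'..<f}"
        using t by (simp add: left_diff_distrib mult_left_mono)
      then show ?thesis using Te True traced_mono by blast
    next
      case False
      then have eb: "Suc e \<le> b" using e by simp
      have "x (Suc e) \<notin> A'"
      proof
        assume "x (Suc e) \<in> A'"
        then have "Suc e \<in> {e. f \<le> e \<and> e \<le> b \<and> x ` {a'..e} \<subseteq> A'}"
          using e eb a' by (auto simp: atLeastAtMostSuc_conv)
        then have "Suc e \<le> e" unfolding e_def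
          by (intro Max_ge) (auto intro: finite_subset[of _ "{..b}"])
        then show False by simp
      qed
      then have c: "pdist c p q \<le> ereal (t * sum w {f..<Suc e})"
        if "p \<in> copies c (x e)" "q \<in> copies c (x (Suc e))" for p q
        using cut[OF _ _ a'(4) _ _ that, of "Suc e"] e eb less.prems(1)
        by (simp only: min_absorb1 max_absorb2) auto
      have "traced c x (Suc e) b (l * sum w {Suc e..<b})"
        by (rule less.hyps) (use eb e a' less.prems in auto)
      then have "traced c x a' b ((l - t) * sum w {a'..<e} + t * sum w {f..<Suc e}
          + l * sum w {Suc e..<b})"
        using e eb a' by (intro traced_join[OF Te _ _ _ c]) auto
      moreover have "(l - t) * sum w {a'..<e} + t * sum w {f..<Suc e} + l * sum w {Suc e..<b}
          \<le> l * sum w {a'..<b} - t * sum w {a'..<f}"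
      proof -
        have 1: "sum w {a'..<b} = sum w {a'..<e} + (w e + sum w {Suc e..<b})"
          using split[of a' e b] sum.atLeast_Suc_lessThan[of e b w] e a' eb by simp
        have 2: "sum w {f..<Suc e} = sum w {f..<e} + w e" using e by simp
        have 3: "sum w {a'..<e} = sum w {a'..<f} + sum w {f..<e}" using split[of a' f e] a' e by simp
        have "0 \<le> w e" using w e eb less.prems by simp
        \<comment> \<open>The edge leaving the run has the full coefficient \<open>l\<close>, which
          covers its share of the cut.\<close>
        then have "t * w e \<le> l * w e" using t by (simp add: mult_right_mono)
        then show ?thesis unfolding 1 2 3 by (simp add: algebra_simps)
      qed
      ultimately show ?thesis by (rule traced_mono)
    qed
  qed
  show ?case
  proof (cases "x ` {a..b} \<inter> A = {}")
    case True
    then show ?thesis using outer less.prems by blast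
  next
    case False
    then have ex: "\<exists>f. a \<le> f \<and> f \<le> b \<and> x f \<in> A" by auto
    define f where "f = (LEAST f. a \<le> f \<and> f \<le> b \<and> x f \<in> A)"
    have f: "a \<le> f" "f \<le> b" "x f \<in> A" using LeastI_ex[OF ex] unfolding f_def by auto
    have fmin: "x i \<notin> A" if "a \<le> i" "i < f" for i
      using not_less_Least[OF that(2)[unfolded f_def]] that f by auto
    show ?thesis
    proof (cases "x ` {a..f} \<subseteq> A'")
      case True
      have "0 \<le> t * sum w {a..<f}" using nn[of f a] t f by auto
      then show ?thesis using f True by (intro traced_mono[OF run[of a f]]) auto
    next
      case False
      \<comment> \<open>\<open>z\<close> is the last position outside \<open>A'\<close> before the
        first visit \<open>f\<close> to \<open>A\<close>. The prefix up to \<open>z\<close> misses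
        \<open>A\<close>, and the cut after \<open>z\<close> is paid by the stretch from
        \<open>z\<close> to \<open>f\<close>, using the reserve kept by \<open>run\<close>.\<close>
      define S where "S = {i. a \<le> i \<and> i \<le> f \<and> x i \<notin> A'}"
      define z where "z = Max S"
      have fin: "finite S" unfolding S_def by (rule finite_subset[of _ "{..f}"]) auto
      have "S \<noteq> {}" using False by (auto simp: S_def)
      then have "z \<in> S" unfolding z_def using fin by simp
      moreover have "f \<noteq> z" using \<open>z \<in> S\<close> AA' f by (auto simp: S_def)
      ultimately have z: "a \<le> z" "z < f" "x z \<notin> A'" by (auto simp: S_def)
      have zmax: "i \<le> z" if "i \<in> S" for i using that fin by (simp add: z_def)
      have "x ` {Suc z..f} \<subseteq> A'"
      proof safe
        fix i assume i: "i \<in> {Suc z..f}"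
        show "x i \<in> A'"
        proof (rule ccontr)
          assume "x i \<notin> A'"
          then have "i \<in> S" using i z by (simp add: S_def)
          then show False using zmax[of i] i by simp
        qed
      qed
      then have R: "traced c x (Suc z) b (l * sum w {Suc z..<b} - t * sum w {Suc z..<f})"
        using run[of "Suc z" f] z f by auto
      have P: "traced c x a z (l * sum w {a..<z})"
      proof (rule outer)
        show "x ` {a..z} \<inter> A = {}" using fmin z by (auto simp: image_iff)
      qed (use z f less.prems in auto)
      have c: "pdist c p q \<le> ereal (t * sum w {z..<f})"
        if "p \<in> copies c (x z)" "q \<in> copies c (x (Suc z))" for p q
        using cut[OF _ _ f(3) z(3) _ that] z f less.prems(1) by (simp add: min_def max_def)
      have "traced c x a b (l * sum w {a..<z} + t * sum w {z..<f}
          + (l * sum w {Suc z..<b} - t * sum w {Suc z..<f}))"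
        using z f by (intro traced_join[OF P R _ _ c]) auto
      moreover have "l * sum w {a..<z} + t * sum w {z..<f}
          + (l * sum w {Suc z..<b} - t * sum w {Suc z..<f}) \<le> l * sum w {a..<b}"
      proof -
        have 1: "sum w {a..<b} = sum w {a..<z} + (w z + sum w {Suc z..<b})"
          using split[of a z b] sum.atLeast_Suc_lessThan[of z b w] z f by simp
        have 2: "sum w {z..<f} = w z + sum w {Suc z..<f}"
          using z by (intro sum.atLeast_Suc_lessThan)
        have "0 \<le> w z" using w z f less.prems by simp
        then have "t * w z \<le> l * w z" using t by (simp add: mult_right_mono)
        then show ?thesis unfolding 1 2 by (simp add: algebra_simps)
      qed
      ultimately show ?thesis by (rule traced_mono)
    qed
  qed
qed

section \<open>Ball growing\<close>

text \<open>\<open>growth\<close> ensures that one of \<open>L\<close> successive enlargements is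
  slow as long as the last ball holds at most half of the mass. Weights of at least 1 keep
  logarithms of masses nonnegative.\<close>

locale clan_construction = hop_metric V D
  for V :: "'a set" and D :: "nat \<Rightarrow> 'a \<Rightarrow> 'a \<Rightarrow> ereal" +
  fixes h L k :: nat and \<mu> :: "'a \<Rightarrow> real"
  assumes L: "1 \<le> L" and k: "1 \<le> k"
    and \<mu>_ge_1: "v \<in> V \<Longrightarrow> 1 \<le> \<mu> v"
    and growth: "ln (sum \<mu> V) \<le> ln 2 * (1 + 1 / real k) ^ L"
begin

text \<open>\<open>H\<close> bounds the hops between two points of a ball with \<open>2 * L\<close>
  steps of \<open>h\<close> hops. The stretch \<open>t\<close> is the ratio of the scale
  \<open>8 * L * \<Delta>\<close> to the step length \<open>\<Delta>\<close>.\<close>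

abbreviation (input) "t \<equiv> 8 * real L"
abbreviation (input) "\<gamma> \<equiv> 1 + 1 / real k"
abbreviation (input) "H \<equiv> 4 * L * h"

text \<open>The invariant of the recursion on a cluster \<open>X\<close> at scale \<open>s\<close>.
  Distances are those of \<open>V\<close>, not of a subgraph induced by \<open>X\<close>. The path
  bound charges an edge \<open>t\<close> per possible halving of the mass. Points are naturals, so
  that two clans can be combined by parity.\<close>

definition partial_clan :: "'a set \<Rightarrow> ereal \<Rightarrow> ('a, nat) clan \<Rightarrow> bool" where
  "partial_clan X s c \<longleftrightarrow>
    ultrametric_on (points c) (pdist c) \<and>
    (\<forall>p\<in>points c. \<forall>q\<in>points c. pdist c p q \<le> s) \<and>
    (\<forall>v\<in>X. finite (copies c v) \<and> copies c v \<subseteq> points c \<and> chief c v \<in> copies c v) \<and>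
    disjoint_family_on (copies c) X \<and>
    (\<forall>u\<in>X. \<forall>v\<in>X. \<forall>p\<in>copies c u. \<forall>q\<in>copies c v. D H u v \<le> pdist c p q) \<and>
    (\<forall>u\<in>X. \<forall>v\<in>X. \<exists>p\<in>copies c v. pdist c p (chief c u) \<le> ereal t * D h u v) \<and>
    (\<forall>x w a b. a \<le> b \<longrightarrow> x ` {a..b} \<subseteq> X \<longrightarrow> hop_path h x w a b \<longrightarrow>
      traced c x a b (t * log 2 (sum \<mu> X) * sum w {a..<b})) \<and>
    (\<Sum>v\<in>X. \<mu> v * real (card (copies c v))) \<le> sum \<mu> X powr \<gamma>"

lemma partial_clanD:
  assumes "partial_clan X s c"
  shows "ultrametric_on (points c) (pdist c)"
    and "\<forall>p\<in>points c. \<forall>q\<in>points c. pdist c p q \<le> s"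
    and "\<forall>v\<in>X. finite (copies c v) \<and> copies c v \<subseteq> points c \<and> chief c v \<in> copies c v"
    and "disjoint_family_on (copies c) X"
    and "\<forall>u\<in>X. \<forall>v\<in>X. \<forall>p\<in>copies c u. \<forall>q\<in>copies c v. D H u v \<le> pdist c p q"
    and "\<forall>u\<in>X. \<forall>v\<in>X. \<exists>p\<in>copies c v. pdist c p (chief c u) \<le> ereal t * D h u v"
    and "\<forall>x w a b. a \<le> b \<longrightarrow> x ` {a..b} \<subseteq> X \<longrightarrow> hop_path h x w a b \<longrightarrow>
      traced c x a b (t * log 2 (sum \<mu> X) * sum w {a..<b})"
    and "(\<Sum>v\<in>X. \<mu> v * real (card (copies c v))) \<le> sum \<mu> X powr \<gamma>"
  using assms unfolding partial_clan_def by - (elim conjE, assumption)+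

lemma partial_clan_mono: "partial_clan X s c \<Longrightarrow> s \<le> s' \<Longrightarrow> partial_clan X s' c"
  unfolding partial_clan_def by (meson order_trans)

lemma \<mu>_nonneg: "v \<in> V \<Longrightarrow> 0 \<le> \<mu> v"
  using \<mu>_ge_1[of v] by simp

lemma sum_\<mu>_ge_1: "X \<subseteq> V \<Longrightarrow> X \<noteq> {} \<Longrightarrow> 1 \<le> sum \<mu> X"
proof -
  assume X: "X \<subseteq> V" "X \<noteq> {}"
  then obtain v where v: "v \<in> X" by auto
  have "\<mu> v \<le> sum \<mu> X"
    using X v finite_V \<mu>_nonneg by (intro member_le_sum) (auto intro: finite_subset)
  then show ?thesis using \<mu>_ge_1[of v] v X by auto
qed

lemma sum_\<mu>_mono: "X \<subseteq> Y \<Longrightarrow> Y \<subseteq> V \<Longrightarrow> sum \<mu> X \<le> sum \<mu> Y"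
  using finite_V \<mu>_nonneg by (intro sum_mono2) (auto intro: finite_subset)

section \<open>Base case and gluing of partial clans\<close>

lemma partial_clan_singleton:
  assumes "v \<in> V" "0 \<le> s"
  shows "\<exists>c. partial_clan {v} s c"
proof -
  define c :: "('a, nat) clan" where
    "c = \<lparr>points = {0}, pdist = (\<lambda>_ _. 0), copies = (\<lambda>_. {0}), chief = (\<lambda>_. 0)\<rparr>"
  have "traced c x a b (t * log 2 (sum \<mu> {v}) * sum w {a..<b})"
    if "x ` {a..b} \<subseteq> {v}" "hop_path h x w a b" for x w a b
  proof -
    have "0 \<le> sum w {a..<b}"
      using hop_path_sum_nonneg[OF that(2)] that(1) assms by blast
    moreover have "0 \<le> log 2 (sum \<mu> {v})" using \<mu>_ge_1[OF assms(1)] by simp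
    ultimately have "0 \<le> t * log 2 (sum \<mu> {v}) * sum w {a..<b}" by simp
    then show ?thesis unfolding traced_def by (auto simp: c_def intro!: exI[of _ "\<lambda>_. 0"])
  qed
  moreover have "\<mu> v \<le> \<mu> v powr \<gamma>"
    using \<mu>_ge_1[OF assms(1)] powr_mono[of 1 "1 + 1 / real k" "\<mu> v"] by simp
  moreover have "ultrametric_on (points c) (pdist c)" by (auto simp: c_def ultrametric_on_def)
  ultimately have "partial_clan {v} s c"
    using assms D_refl[OF assms(1)] unfolding partial_clan_def
    by (auto simp: c_def disjoint_family_on_def)
  then show ?thesis by blast
qed

text \<open>The clans of \<open>A'\<close> and \<open>X - A\<close> are placed at mutual distance
  \<open>s\<close>, so vertices of \<open>A' - A\<close> get copies in both. The chief of
  \<open>u\<close> goes to the side of \<open>A'\<close> iff \<open>u\<close> is in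
  \<open>M\<close>: a vertex without a copy on the side of that chief is then far from
  \<open>u\<close>, by \<open>cut2\<close> if \<open>u\<close> is in \<open>M\<close> and by
  \<open>cut1\<close> otherwise.\<close>

lemma partial_clan_join:
  assumes X: "X \<subseteq> V" and sets: "A \<subseteq> M" "M \<subseteq> A'" "A' \<subseteq> X" "A \<noteq> {}"
    and half: "sum \<mu> A' \<le> sum \<mu> X / 2"
    and grow: "sum \<mu> A' powr \<gamma> \<le> sum \<mu> A * sum \<mu> X powr (1 / real k)"
    and c1: "partial_clan A' s c1" and c2: "partial_clan (X - A) s c2"
    and s: "0 < s" and dom: "\<And>u v. u \<in> X \<Longrightarrow> v \<in> X \<Longrightarrow> D H u v \<le> s"
    and cut1: "\<And>u v. u \<in> A \<Longrightarrow> v \<in> X - M \<Longrightarrow> s \<le> ereal t * D h u v"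
    and cut2: "\<And>u v. u \<in> M \<Longrightarrow> v \<in> X - A' \<Longrightarrow> s \<le> ereal t * D h u v"
  shows "\<exists>c. partial_clan X s c"
proof -
  define e1 e2 :: "nat \<Rightarrow> nat" where "e1 = (\<lambda>i. 2 * i)" and "e2 = (\<lambda>i. 2 * i + 1)"
  define c :: "('a, nat) clan" where "c = \<lparr>points = e1 ` points c1 \<union> e2 ` points c2,
    pdist = (\<lambda>p q. if even p \<and> even q then pdist c1 (p div 2) (q div 2)
      else if odd p \<and> odd q then pdist c2 (p div 2) (q div 2) else s),
    copies = (\<lambda>v. (if v \<in> A' then e1 ` copies c1 v else {}) \<union>
      (if v \<in> X - A then e2 ` copies c2 v else {})),
    chief = (\<lambda>v. if v \<in> M then e1 (chief c1 v) else e2 (chief c2 v))\<rparr>"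
  have pts: "points c = e1 ` points c1 \<union> e2 ` points c2" by (simp add: c_def)
  have pd [simp]: "pdist c (e1 i) (e1 j) = pdist c1 i j" "pdist c (e2 i) (e2 j) = pdist c2 i j"
    "pdist c (e1 i) (e2 j) = s" "pdist c (e2 i) (e1 j) = s" for i j
    by (auto simp: c_def e1_def e2_def)
  have cp: "copies c v = (if v \<in> A' then e1 ` copies c1 v else {}) \<union>
      (if v \<in> X - A then e2 ` copies c2 v else {})" for v
    by (simp add: c_def)
  have ch: "chief c v = (if v \<in> M then e1 (chief c1 v) else e2 (chief c2 v))" for v
    by (simp add: c_def)
  have e [simp]: "e1 i = e1 j \<longleftrightarrow> i = j" "e2 i = e2 j \<longleftrightarrow> i = j" "e1 i \<noteq> e2 j" "e2 i \<noteq> e1 j" for i j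
    unfolding e1_def e2_def by presburger+
  note C1 = partial_clanD[OF c1] and C2 = partial_clanD[OF c2]
  have t0: "0 \<le> t" by simp
  have fX: "finite X" using X finite_V finite_subset by blast
  have AX: "A \<subseteq> X" and AV: "A \<subseteq> V" "A' \<subseteq> V" "A' \<noteq> {}" using sets X by blast+
  have nnX: "0 \<le> sum \<mu> (X - A)" using X by (intro sum_nonneg \<mu>_nonneg) auto
  have mu: "1 \<le> sum \<mu> A'" "1 \<le> sum \<mu> A" "sum \<mu> X = sum \<mu> A + sum \<mu> (X - A)"
    "sum \<mu> (X - A) \<le> sum \<mu> X" "0 \<le> sum \<mu> (X - A)"
    using sum_\<mu>_ge_1[of A'] sum_\<mu>_ge_1[of A] AV sets sum.subset_diff[OF AX fX, of \<mu>]
      sum_\<mu>_mono[of "X - A" X] X nnX by auto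
  have um: "ultrametric_on (points c) (pdist c)"
  proof -
    have u: "ultrametric_on (points c1) (pdist c1)" "ultrametric_on (points c2) (pdist c2)"
      and le: "\<forall>p\<in>points c1. \<forall>q\<in>points c1. pdist c1 p q \<le> s"
        "\<forall>p\<in>points c2. \<forall>q\<in>points c2. pdist c2 p q \<le> s"
      using C1(1,2) C2(1,2) by blast+
    have s0: "0 \<le> s" "s \<noteq> 0" using s by auto
    have 1: "0 \<le> pdist c x y \<and> (pdist c x y = 0 \<longleftrightarrow> x = y) \<and> pdist c x y = pdist c y x"
      if "x \<in> points c" "y \<in> points c" for x y
      using that u s0 unfolding ultrametric_on_def pts by (elim UnE imageE) simp_all
    have 2: "pdist c x z \<le> max (pdist c x y) (pdist c y z)"
      if "x \<in> points c" "y \<in> points c" "z \<in> points c" for x y z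
      using that u le unfolding ultrametric_on_def pts
      by (elim UnE imageE) (simp_all add: max.coboundedI1 max.coboundedI2)
    show ?thesis using 1 2 by (simp add: ultrametric_on_def)
  qed
  have le: "\<forall>p\<in>points c. \<forall>q\<in>points c. pdist c p q \<le> s"
    using C1(2) C2(2) unfolding pts by auto
  have cps: "finite (copies c v) \<and> copies c v \<subseteq> points c \<and> chief c v \<in> copies c v" if "v \<in> X" for v
  proof -
    have "v \<in> A' \<longrightarrow> finite (copies c1 v) \<and> copies c1 v \<subseteq> points c1 \<and> chief c1 v \<in> copies c1 v"
      "v \<in> X - A \<longrightarrow> finite (copies c2 v) \<and> copies c2 v \<subseteq> points c2 \<and> chief c2 v \<in> copies c2 v"
      using C1(3) C2(3) by blast+
    moreover have "v \<in> M \<longrightarrow> v \<in> A'" "v \<notin> M \<longrightarrow> v \<in> X - A" using sets that by blast+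
    ultimately show ?thesis unfolding pts cp ch by (cases "v \<in> M"; cases "v \<in> A'") auto
  qed
  have mem: "p \<in> copies c v \<longleftrightarrow> (\<exists>i. v \<in> A' \<and> p = e1 i \<and> i \<in> copies c1 v) \<or>
      (\<exists>i. v \<in> X - A \<and> p = e2 i \<and> i \<in> copies c2 v)" for p v
    unfolding cp by auto
  have disj: "disjoint_family_on (copies c) X"
  proof -
    have "disjoint_family_on (copies c1) A'" "disjoint_family_on (copies c2) (X - A)"
      using C1(4) C2(4) by blast+
    then have d1: "u \<in> A' \<Longrightarrow> v \<in> A' \<Longrightarrow> i \<in> copies c1 u \<Longrightarrow> i \<in> copies c1 v \<Longrightarrow> u = v"
      and d2: "u \<in> X - A \<Longrightarrow> v \<in> X - A \<Longrightarrow> i \<in> copies c2 u \<Longrightarrow> i \<in> copies c2 v \<Longrightarrow> u = v" for u v i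
      unfolding disjoint_family_on_def by blast+
    have "u = v" if "p \<in> copies c u" "p \<in> copies c v" for p u v
      using that unfolding mem by (metis d1 d2 e)
    then show ?thesis unfolding disjoint_family_on_def by blast
  qed
  have domc: "\<forall>u\<in>X. \<forall>v\<in>X. \<forall>p\<in>copies c u. \<forall>q\<in>copies c v. D H u v \<le> pdist c p q"
  proof (intro ballI)
    fix u v p q assume "u \<in> X" "v \<in> X" "p \<in> copies c u" "q \<in> copies c v"
    moreover have "\<forall>u\<in>A'. \<forall>v\<in>A'. \<forall>p\<in>copies c1 u. \<forall>q\<in>copies c1 v. D H u v \<le> pdist c1 p q"
      "\<forall>u\<in>X - A. \<forall>v\<in>X - A. \<forall>p\<in>copies c2 u. \<forall>q\<in>copies c2 v. D H u v \<le> pdist c2 p q"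
      using C1(5) C2(5) by blast+
    ultimately show "D H u v \<le> pdist c p q" using dom[of u v]
      unfolding mem by (elim disjE exE conjE) simp_all
  qed
  have dist: "\<exists>p\<in>copies c v. pdist c p (chief c u) \<le> ereal t * D h u v" if uv: "u \<in> X" "v \<in> X" for u v
  proof -
    have any: "\<exists>p. p \<in> copies c v" and chu: "chief c u \<in> points c" and sub: "copies c v \<subseteq> points c"
      using cps uv by blast+
    show ?thesis
    proof (cases "u \<in> M")
      case uM: True
      show ?thesis
      proof (cases "v \<in> A'")
        case True
        then obtain q where "q \<in> copies c1 v" "pdist c1 q (chief c1 u) \<le> ereal t * D h u v"
          using C1(6) uM sets by blast
        then show ?thesis unfolding ch using True uM
          by (intro bexI[of _ "e1 q"]) (auto simp: cp)
      next
        case False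
        then have "s \<le> ereal t * D h u v" using cut2 uM uv by blast
        then show ?thesis using any le chu sub by (meson order_trans subsetD)
      qed
    next
      case uM: False
      show ?thesis
      proof (cases "v \<in> A")
        case False
        then obtain q where "q \<in> copies c2 v" "pdist c2 q (chief c2 u) \<le> ereal t * D h u v"
          using C2(6) uM uv sets by blast
        then show ?thesis unfolding ch using False uM uv
          by (intro bexI[of _ "e2 q"]) (auto simp: cp)
      next
        case True
        then have "s \<le> ereal t * D h v u" using cut1 uM uv by blast
        also have "D h v u = D h u v" using uv X by (auto intro: D_sym)
        finally show ?thesis using any le chu sub by (meson order_trans subsetD)
      qed
    qed
  qed
  have path: "traced c x a b (t * log 2 (sum \<mu> X) * sum w {a..<b})"
    if ab: "a \<le> b" and xX: "x ` {a..b} \<subseteq> X" and hp: "hop_path h x w a b" for x w a b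
  proof -
    \<comment> \<open>\<open>traced_cut\<close> speaks about paths that start at index 0.\<close>
    define x' w' where "x' i = x (i + a)" and "w' i = w (i + a)" for i
    have sh: "sum w' {i..<j} = sum w {i + a..<j + a}" for i j
      unfolding w'_def by (simp add: sum.shift_bounds_nat_ivl)
    have xX': "x' ` {0..b - a} \<subseteq> X" using xX ab by (auto simp: x'_def)
    have hp': "hop_path h x' w' 0 (b - a)"
      using hp ab unfolding hop_path_def sh x'_def by auto
    let ?l = "t * log 2 (sum \<mu> X)"
    \<comment> \<open>Halving the mass lowers the logarithm by 1; multiplied by \<open>t\<close>,
      this is the reduction of the coefficient that \<open>traced_cut\<close> requires inside
      \<open>A'\<close>.\<close>
    have log: "log 2 (sum \<mu> A') \<le> log 2 (sum \<mu> X) - 1" "1 \<le> log 2 (sum \<mu> X)"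
    proof -
      have "log 2 (sum \<mu> A') \<le> log 2 (sum \<mu> X / 2)" using mu half by (intro log_mono) auto
      also have "\<dots> = log 2 (sum \<mu> X) - 1" using mu by (subst log_divide) auto
      finally show "log 2 (sum \<mu> A') \<le> log 2 (sum \<mu> X) - 1" .
      moreover have "0 \<le> log 2 (sum \<mu> A')" using mu by simp
      ultimately show "1 \<le> log 2 (sum \<mu> X)" by simp
    qed
    have sub: "hop_path h x' w' i j" if "j \<le> b - a" for i j
      using hop_path_subpath[OF hp'] that by auto
    have nn: "0 \<le> sum w' {i..<j}" if "j \<le> b - a" for i j
      using hop_path_sum_nonneg[OF hp'] xX' X that by auto
    have mono: "traced c' x' i j (y * sum w' {i..<j}) \<Longrightarrow> y \<le> z \<Longrightarrow> j \<le> b - a \<Longrightarrow>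
        traced c' x' i j (z * sum w' {i..<j})" for c' :: "('a, nat) clan" and i j y z
      using nn by (elim traced_mono) (simp add: mult_right_mono)
    have "traced c x' 0 (b - a) (?l * sum w' {0..<b - a})"
    proof (rule traced_cut[where A = A and A' = A' and m = "b - a" and t = t])
      fix i j assume ij: "i \<le> j" "j \<le> b - a" "x' ` {i..j} \<subseteq> A'"
      have "traced c1 x' i j (t * log 2 (sum \<mu> A') * sum w' {i..<j})"
        using C1(7) ij sub[of j i] by blast
      moreover have "t * log 2 (sum \<mu> A') \<le> ?l - t"
        using log(1) mult_left_mono[OF log(1) t0] by (simp add: algebra_simps)
      ultimately have "traced c1 x' i j ((?l - t) * sum w' {i..<j})" using mono ij by blast
      then obtain s where s: "\<forall>l\<in>{i..j}. s l \<in> copies c1 (x' l)"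
        "(\<Sum>l\<in>{i..<j}. pdist c1 (s l) (s (Suc l))) \<le> ereal ((?l - t) * sum w' {i..<j})"
        unfolding traced_def by blast
      then show "traced c x' i j ((?l - t) * sum w' {i..<j})"
        unfolding traced_def cp using ij by (intro exI[of _ "\<lambda>l. e1 (s l)"]) auto
    next
      fix i j assume ij: "i \<le> j" "j \<le> b - a" "x' ` {i..j} \<inter> A = {}"
      have sub': "x' ` {i..j} \<subseteq> X - A" using ij xX' by fastforce
      have "traced c2 x' i j (t * log 2 (sum \<mu> (X - A)) * sum w' {i..<j})"
        using C2(7) ij sub' sub[of j i] by blast
      moreover have "log 2 (sum \<mu> (X - A)) \<le> log 2 (sum \<mu> X)"
      proof (rule log_mono)
        have "X - A \<noteq> {}" using sub' ij by fastforce
        then have "1 \<le> sum \<mu> (X - A)" using X by (intro sum_\<mu>_ge_1) auto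
        then show "0 < sum \<mu> (X - A)" by simp
      qed (use mu in auto)
      ultimately have "traced c2 x' i j (?l * sum w' {i..<j})"
        using mono ij t0 by (meson mult_left_mono)
      then obtain s where s: "\<forall>l\<in>{i..j}. s l \<in> copies c2 (x' l)"
        "(\<Sum>l\<in>{i..<j}. pdist c2 (s l) (s (Suc l))) \<le> ereal (?l * sum w' {i..<j})"
        unfolding traced_def by blast
      then show "traced c x' i j (?l * sum w' {i..<j})"
        unfolding traced_def cp using ij sub' by (intro exI[of _ "\<lambda>l. e2 (s l)"]) fastforce
    next
      fix f z q r i assume fz: "f \<le> b - a" "z \<le> b - a" "x' f \<in> A" "x' z \<notin> A'" "i < b - a"
        "q \<in> copies c (x' i)" "r \<in> copies c (x' (Suc i))"
      have inX: "x' i \<in> X" "x' (Suc i) \<in> X" "x' f \<in> X" "x' z \<in> X" using xX' fz by auto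
      then have "q \<in> points c" "r \<in> points c" using cps fz by blast+
      \<comment> \<open>\<open>s\<close> bounds all distances and, by \<open>cut2\<close>, is at
        most \<open>t\<close> times the length of a stretch between \<open>A\<close> and the outside
        of \<open>A'\<close>.\<close>
      then have "pdist c q r \<le> s" using le by blast
      also have "s \<le> ereal t * D h (x' f) (x' z)" using cut2 sets fz inX by blast
      also have "D h (x' f) (x' z) = D h (x' (min f z)) (x' (max f z))"
        using D_sym inX X by (auto simp: min_def max_def)
      also have "ereal t * D h (x' (min f z)) (x' (max f z)) \<le> ereal t * ereal (sum w' {min f z..<max f z})"
        using hp' fz t0 unfolding hop_path_def by (intro ereal_mult_left_mono) auto
      finally show "pdist c q r \<le> ereal (t * sum w' {min f z..<max f z})" by simp
    next
      show "0 \<le> w' i" if "i < b - a" for i using nn[of "Suc i" i] that by simp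
      show "A \<subseteq> A'" using sets by blast
      show "t \<le> ?l" using mult_left_mono[OF log(2) t0] by simp
    qed auto
    then obtain s where "\<forall>i\<in>{0..b - a}. s i \<in> copies c (x (i + a))"
      "(\<Sum>i\<in>{0..<b - a}. pdist c (s i) (s (Suc i))) \<le> ereal (?l * sum w {a..<b})"
      unfolding traced_def sh x'_def using ab by auto
    moreover have "(\<Sum>i\<in>{a..<b}. pdist c (s (i - a)) (s (Suc i - a)))
        = (\<Sum>i\<in>{0..<b - a}. pdist c (s i) (s (Suc i)))"
      using sum.shift_bounds_nat_ivl[of "\<lambda>i. pdist c (s (i - a)) (s (Suc i - a))" 0 a "b - a"] ab
      by simp
    moreover have "s (i - a) \<in> copies c (x i)" if "i \<in> {a..b}" for i
      using that bspec[OF \<open>\<forall>i\<in>{0..b - a}. s i \<in> copies c (x (i + a))\<close>, of "i - a"] by auto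
    ultimately show ?thesis unfolding traced_def by (intro exI[of _ "\<lambda>i. s (i - a)"]) simp
  qed
  have cnt: "(\<Sum>v\<in>X. \<mu> v * real (card (copies c v))) \<le> sum \<mu> X powr \<gamma>"
  proof -
    have card: "real (card (copies c v)) = (if v \<in> A' then real (card (copies c1 v)) else 0)
        + (if v \<in> X - A then real (card (copies c2 v)) else 0)" if "v \<in> X" for v
    proof -
      have "finite (if v \<in> A' then e1 ` copies c1 v else {})"
        "finite (if v \<in> X - A then e2 ` copies c2 v else {})" using C1(3) C2(3) by auto
      then have "card (copies c v) = card (if v \<in> A' then e1 ` copies c1 v else {})
        + card (if v \<in> X - A then e2 ` copies c2 v else {})"
        unfolding cp by (intro card_Un_disjoint) auto
      moreover have "inj_on e1 S" "inj_on e2 S" for S by (auto simp: inj_on_def)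
      ultimately show ?thesis by (simp add: card_image)
    qed
    have restrict: "(\<Sum>v\<in>X. if v \<in> S then f v else 0) = sum f S"
      if "S \<subseteq> X" for S and f :: "'a \<Rightarrow> real"
      using that by (simp add: sum.inter_restrict[OF fX, symmetric] Int_absorb1)
    have "(\<Sum>v\<in>X. \<mu> v * real (card (copies c v))) =
        (\<Sum>v\<in>X. if v \<in> A' then \<mu> v * real (card (copies c1 v)) else 0)
        + (\<Sum>v\<in>X. if v \<in> X - A then \<mu> v * real (card (copies c2 v)) else 0)"
      unfolding sum.distrib[symmetric] by (intro sum.cong) (auto simp: card algebra_simps)
    also have "\<dots> = (\<Sum>v\<in>A'. \<mu> v * real (card (copies c1 v)))
        + (\<Sum>v\<in>X - A. \<mu> v * real (card (copies c2 v)))"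
      using restrict[of A'] restrict[of "X - A"] sets by simp
    also have "\<dots> \<le> sum \<mu> A' powr \<gamma> + sum \<mu> (X - A) powr \<gamma>"
      using C1(8) C2(8) by (intro add_mono)
    \<comment> \<open>One factor of the mass is split off. As \<open>grow\<close> prices the copies
      in \<open>A'\<close> at the mass of \<open>A\<close> alone, both parts add up to the mass of
      \<open>X\<close> at the common rate \<open>sum \<mu> X powr (1 / real k)\<close>.\<close>
    also have "sum \<mu> (X - A) powr \<gamma> = sum \<mu> (X - A) * sum \<mu> (X - A) powr (1 / real k)"
      using mu by (simp add: powr_add powr_one)
    also have "\<dots> \<le> sum \<mu> (X - A) * sum \<mu> X powr (1 / real k)"
      using mu by (intro mult_left_mono powr_mono2) auto
    also have "sum \<mu> A' powr \<gamma> + \<dots> \<le> (sum \<mu> A + sum \<mu> (X - A)) * sum \<mu> X powr (1 / real k)"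
      using grow by (simp add: algebra_simps)
    also have "\<dots> = sum \<mu> X powr \<gamma>" using mu by (simp add: powr_add)
    finally show ?thesis by simp
  qed
  have "partial_clan X s c" unfolding partial_clan_def
    by (intro conjI um le disj domc cnt; intro ballI allI impI cps dist path; assumption)
  then show ?thesis by blast
qed

text \<open>
  In the recursion \<open>ln m - ln (a j)\<close> shrinks by the factor \<open>\<gamma>\<close> at each step at which the ball grows
  too fast, so after \<open>L\<close> such steps the ball would hold more than half of the mass.
\<close>

lemma slow_growth_step:
  fixes a :: "nat \<Rightarrow> real"
  assumes a: "\<And>j. 1 \<le> a j" and half: "a L \<le> m / 2" and m: "1 \<le> m" "m \<le> sum \<mu> V"
  shows "\<exists>j<L. a (Suc j) powr \<gamma> \<le> a j * m powr (1 / real k)"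
proof (rule ccontr)
  assume "\<not> ?thesis"
  then have fast: "a j * m powr (1 / real k) < a (Suc j) powr \<gamma>" if "j < L" for j
    using that by (meson not_le)
  define b where "b j = ln m - ln (a j)" for j
  have \<gamma>: "0 < \<gamma>" "\<gamma> * ln m = ln m + ln m / real k" by (auto simp: algebra_simps add_pos_nonneg)
  have step: "\<gamma> * b (Suc j) < b j" if "j < L" for j
  proof -
    have pos: "0 < a j" "0 < a (Suc j)" using a[of j] a[of "Suc j"] by auto
    then have "ln (a j * m powr (1 / real k)) < ln (a (Suc j) powr \<gamma>)"
      using fast[OF that] m by (intro ln_less_cancel_iff[THEN iffD2]) auto
    then have "ln (a j) + ln m / real k < \<gamma> * ln (a (Suc j))"
      using pos m by (simp add: ln_mult ln_powr)
    then show ?thesis using \<gamma> by (simp add: b_def right_diff_distrib)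
  qed
  \<comment> \<open>Only positive \<open>j\<close>: the inequality is strict and becomes an equality
    at 0.\<close>
  have "j \<le> L \<Longrightarrow> 0 < j \<Longrightarrow> \<gamma> ^ j * b j < b 0" for j
  proof (induction j)
    case (Suc j)
    have "\<gamma> ^ Suc j * b (Suc j) = \<gamma> ^ j * (\<gamma> * b (Suc j))" by simp
    also have "\<dots> < \<gamma> ^ j * b j" using step[of j] Suc.prems \<gamma> by (intro mult_strict_left_mono) auto
    also have "\<dots> \<le> b 0" using Suc by (cases "j = 0") auto
    finally show ?case .
  qed simp
  then have "\<gamma> ^ L * b L < b 0" using L by auto
  moreover have "ln 2 \<le> b L"
  proof -
    have "ln (a L) \<le> ln (m / 2)" using half a[of L] m by (intro ln_mono) auto
    then show ?thesis using m by (simp add: b_def ln_div)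
  qed
  moreover have "b 0 \<le> ln m" using a[of 0] by (simp add: b_def)
  moreover have "ln m \<le> ln (sum \<mu> V)" using m by (intro ln_mono) auto
  moreover have "ln 2 * \<gamma> ^ L \<le> \<gamma> ^ L * b L"
    using mult_right_mono[OF \<open>ln 2 \<le> b L\<close>, of "\<gamma> ^ L"] \<gamma> by (simp add: mult.commute)
  ultimately show False using growth by linarith
qed

section \<open>Balls and the decomposition at one scale\<close>

definition hball :: "'a set \<Rightarrow> 'a \<Rightarrow> real \<Rightarrow> nat \<Rightarrow> 'a set" where
  "hball X v \<Delta> j = {u \<in> X. D (j * h) v u \<le> ereal (real j * \<Delta>)}"

lemma hball_center: "v \<in> X \<Longrightarrow> X \<subseteq> V \<Longrightarrow> 0 \<le> \<Delta> \<Longrightarrow> v \<in> hball X v \<Delta> j"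
  unfolding hball_def by (auto simp: D_refl subset_iff)

lemma hball_mono: "i \<le> j \<Longrightarrow> 0 \<le> \<Delta> \<Longrightarrow> hball X v \<Delta> i \<subseteq> hball X v \<Delta> j"
proof safe
  fix u assume ij: "i \<le> j" and \<Delta>: "0 \<le> \<Delta>" and u: "u \<in> hball X v \<Delta> i"
  have "D (j * h) v u \<le> D (i * h) v u" using ij by (intro D_antimono mult_le_mono1)
  also have "\<dots> \<le> ereal (real i * \<Delta>)" using u by (simp add: hball_def)
  also have "\<dots> \<le> ereal (real j * \<Delta>)" using ij \<Delta> by (simp add: mult_right_mono)
  finally show "u \<in> hball X v \<Delta> j" using u by (simp add: hball_def)
qed

text \<open>Read contrapositively: vertices separated by a full step of a ball have
  \<open>h\<close>-hop distance above \<open>\<Delta>\<close>. This yields the cut conditions for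
  \<open>partial_clan_join\<close>.\<close>

lemma hball_step:
  assumes "v \<in> X" "X \<subseteq> V" "u \<in> hball X v \<Delta> j" "z \<in> X" "D h u z \<le> ereal \<Delta>"
  shows "z \<in> hball X v \<Delta> (Suc j)"
proof -
  have "D (Suc j * h) v z \<le> ereal (real (Suc j) * \<Delta>)"
    by (rule D_triangle_le[of v u z "j * h" "real j * \<Delta>" h \<Delta>])
      (use assms in \<open>auto simp: hball_def algebra_simps\<close>)
  then show ?thesis using assms by (simp add: hball_def)
qed

text \<open>The two radii are joined at the centre. The diameter is a weak one: it is measured in
  \<open>V\<close>, so the connection need not stay inside \<open>X\<close>.\<close>

lemma hball_diam:
  assumes "v \<in> X" "X \<subseteq> V" "u \<in> hball X v \<Delta> i" "z \<in> hball X v \<Delta> i"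
  shows "D (2 * i * h) u z \<le> ereal (2 * real i * \<Delta>)"
proof (rule D_triangle_le[of u v z "i * h" "real i * \<Delta>" "i * h" "real i * \<Delta>"])
  show "D (i * h) u v \<le> ereal (real i * \<Delta>)"
    using assms D_sym[of u v "i * h"] by (auto simp: hball_def subset_iff)
qed (use assms in \<open>auto simp: hball_def algebra_simps\<close>)

text \<open>Clusters at scale \<open>s\<close> are assembled from those of diameter
  \<open>4 * L * \<Delta>\<close>, which \<open>sub\<close> provides. \<open>s\<close> is tied to
  \<open>\<Delta>\<close> only by the last two hypotheses, so the lemma serves both for doubling a
  scale and for the final step to infinity. The induction on \<open>card X\<close> peels off one
  ball at a time.\<close>

lemma partial_clan_step:
  assumes \<Delta>: "0 < \<Delta>"
    and sub: "\<And>X. X \<subseteq> V \<Longrightarrow> X \<noteq> {} \<Longrightarrow> (\<And>u v. u \<in> X \<Longrightarrow> v \<in> X \<Longrightarrow> D H u v \<le> ereal (4 * real L * \<Delta>))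
        \<Longrightarrow> \<exists>c. partial_clan X (ereal (4 * real L * \<Delta>)) c"
    and s: "ereal (4 * real L * \<Delta>) \<le> s"
    and far: "\<And>u v. u \<in> V \<Longrightarrow> v \<in> V \<Longrightarrow> D h u v \<le> ereal \<Delta> \<or> s \<le> ereal t * D h u v"
  shows "X \<subseteq> V \<Longrightarrow> X \<noteq> {} \<Longrightarrow> (\<And>u v. u \<in> X \<Longrightarrow> v \<in> X \<Longrightarrow> D H u v \<le> s) \<Longrightarrow>
    \<exists>c. partial_clan X s c"
proof (induction "card X" arbitrary: X rule: less_induct)
  case less
  have fX: "finite X" using less.prems finite_V finite_subset by blast
  have \<Delta>0: "0 \<le> \<Delta>" and L0: "0 < 4 * real L * \<Delta>" using \<Delta> L by auto
  have sball: "1 \<le> sum \<mu> (hball X v \<Delta> j)" if "v \<in> X" for v j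
    using hball_center[OF that less.prems(1) \<Delta>0] less.prems(1)
    by (intro sum_\<mu>_ge_1) (auto simp: hball_def)
  show ?case
  proof (cases "\<forall>v\<in>X. sum \<mu> X / 2 < sum \<mu> (hball X v \<Delta> (2 * L))")
    case True
    have "D H u v \<le> ereal (4 * real L * \<Delta>)" if uv: "u \<in> X" "v \<in> X" for u v
    proof -
      \<comment> \<open>Two sets that each hold more than half of the mass of \<open>X\<close>
        intersect; a common vertex connects \<open>u\<close> and \<open>v\<close> within twice the
        radius.\<close>
      have "\<exists>z. z \<in> hball X u \<Delta> (2 * L) \<inter> hball X v \<Delta> (2 * L)"
      proof (rule ccontr)
        assume "\<not> ?thesis"
        then have "sum \<mu> (hball X u \<Delta> (2 * L)) + sum \<mu> (hball X v \<Delta> (2 * L))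
            = sum \<mu> (hball X u \<Delta> (2 * L) \<union> hball X v \<Delta> (2 * L))"
          using fX by (intro sum.union_disjoint[symmetric]) (auto simp: hball_def)
        also have "\<dots> \<le> sum \<mu> X" using less.prems by (intro sum_\<mu>_mono) (auto simp: hball_def)
        finally show False using bspec[OF True uv(1)] bspec[OF True uv(2)] by linarith
      qed
      then obtain z where z: "z \<in> X" "D (2 * L * h) u z \<le> ereal (real (2 * L) * \<Delta>)"
        "D (2 * L * h) v z \<le> ereal (real (2 * L) * \<Delta>)" by (auto simp: hball_def)
      moreover have "u \<in> V" "v \<in> V" "z \<in> V" using uv z less.prems(1) by auto
      ultimately show ?thesis
        using D_sym[of v z "2 * L * h"]
        by (intro D_triangle_le[of u z v "2 * L * h" "real (2 * L) * \<Delta>" "2 * L * h" "real (2 * L) * \<Delta>"])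
          (auto simp: algebra_simps)
    qed
    then show ?thesis using sub[of X] less.prems s partial_clan_mono by blast
  next
    case False
    then obtain v where v: "v \<in> X" "sum \<mu> (hball X v \<Delta> (2 * L)) \<le> sum \<mu> X / 2" by (auto simp: not_less)
    \<comment> \<open>Only even radii enter the growth argument; the odd radius in between is kept
      for the set \<open>M\<close> that places the chiefs.\<close>
    define a where "a j = sum \<mu> (hball X v \<Delta> (2 * j))" for j
    have "\<exists>j<L. a (Suc j) powr \<gamma> \<le> a j * sum \<mu> X powr (1 / real k)"
    proof (rule slow_growth_step)
      show "1 \<le> sum \<mu> X" using less.prems by (intro sum_\<mu>_ge_1)
      show "sum \<mu> X \<le> sum \<mu> V" using less.prems by (intro sum_\<mu>_mono) auto
    qed (use sball v in \<open>auto simp: a_def\<close>)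
    then obtain j where j: "j < L" "a (Suc j) powr \<gamma> \<le> a j * sum \<mu> X powr (1 / real k)" by blast
    define A M A' where "A = hball X v \<Delta> (2 * j)" and "M = hball X v \<Delta> (Suc (2 * j))"
      and "A' = hball X v \<Delta> (Suc (Suc (2 * j)))"
    have sets: "A \<subseteq> M" "M \<subseteq> A'" "A' \<subseteq> X" "v \<in> A"
    proof -
      show "A \<subseteq> M" "M \<subseteq> A'" unfolding A_def M_def A'_def by (intro hball_mono \<Delta>0; simp)+
      show "A' \<subseteq> X" unfolding A'_def hball_def by blast
      show "v \<in> A" unfolding A_def by (rule hball_center[OF v(1) less.prems(1) \<Delta>0])
    qed
    \<comment> \<open>As \<open>j < L\<close>, the outermost radius \<open>2 * j + 2\<close> is at
      most \<open>2 * L\<close>, which gives \<open>A'\<close> both the small diameter and at most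
      half of the mass.\<close>
    have A'L: "A' \<subseteq> hball X v \<Delta> (2 * L)" unfolding A'_def using j by (intro hball_mono \<Delta>0) auto
    have mA': "sum \<mu> A' \<le> sum \<mu> X / 2"
      using sum_\<mu>_mono[OF A'L] v(2) less.prems(1) by (fastforce simp: hball_def)
    have "\<exists>c. partial_clan A' (ereal (4 * real L * \<Delta>)) c"
    proof (rule sub)
      fix u z assume "u \<in> A'" "z \<in> A'"
      then show "D H u z \<le> ereal (4 * real L * \<Delta>)"
        using hball_diam[OF v(1) less.prems(1), of u \<Delta> "2 * L" z] A'L by auto
    qed (use sets less.prems in auto)
    then obtain c1 where c1: "partial_clan A' s c1" using partial_clan_mono s by blast
    \<comment> \<open>The induction hypothesis asks for a nonempty complement; a ball with at most
      half of the mass cannot be all of \<open>X\<close>.\<close>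
    have "X \<noteq> A"
    proof
      assume "X = A"
      then have "A' = X" using sets by blast
      then have "sum \<mu> X \<le> sum \<mu> X / 2" using mA' by simp
      then show False using sum_\<mu>_ge_1[OF less.prems(1,2)] by simp
    qed
    then have "\<exists>c. partial_clan (X - A) s c"
      using sets fX less.prems v
      by (intro less.hyps psubset_card_mono) auto
    then obtain c2 where c2: "partial_clan (X - A) s c2" by blast
    have far': "s \<le> ereal t * D h u z" if "u \<in> X" "z \<in> X" "\<not> D h u z \<le> ereal \<Delta>" for u z
      using far that less.prems(1) by blast
    show ?thesis
    proof (rule partial_clan_join[OF less.prems(1) sets(1-3) _ mA' _ c1 c2])
      show "sum \<mu> A' powr \<gamma> \<le> sum \<mu> A * sum \<mu> X powr (1 / real k)"
        using j(2) by (simp add: a_def A_def A'_def)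
      show "0 < s" using s L0 by (metis ereal_less(2) less_le_trans)
      show "s \<le> ereal t * D h u z" if "u \<in> A" "z \<in> X - M" for u z
        using that hball_step[OF v(1) less.prems(1), of u \<Delta> "2 * j" z] sets
        by (intro far') (auto simp: A_def M_def)
      show "s \<le> ereal t * D h u z" if "u \<in> M" "z \<in> X - A'" for u z
        using that hball_step[OF v(1) less.prems(1), of u \<Delta> "Suc (2 * j)" z] sets
        by (intro far') (auto simp: M_def A'_def)
    qed (use sets less.prems in auto)
  qed
qed

section \<open>Recursion over the scales\<close>

lemma partial_clan_scale:
  assumes \<sigma>: "0 < \<sigma>" "\<And>u v. u \<in> V \<Longrightarrow> v \<in> V \<Longrightarrow> u \<noteq> v \<Longrightarrow> ereal \<sigma> < D H u v"
  shows "X \<subseteq> V \<Longrightarrow> X \<noteq> {} \<Longrightarrow> (\<And>u v. u \<in> X \<Longrightarrow> v \<in> X \<Longrightarrow> D H u v \<le> ereal (\<sigma> * 2 ^ i)) \<Longrightarrow>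
    \<exists>c. partial_clan X (ereal (\<sigma> * 2 ^ i)) c"
proof (induction i arbitrary: X)
  case 0
  then obtain v where v: "v \<in> X" by auto
  \<comment> \<open>The lowest scale \<open>\<sigma>\<close> lies below all \<open>H\<close>-hop
    distances of distinct vertices.\<close>
  have "X = {v}"
  proof (rule ccontr)
    assume "X \<noteq> {v}"
    then obtain u where u: "u \<in> X" "u \<noteq> v" using v by auto
    then have "u \<in> V" "v \<in> V" using 0(1) v by auto
    then show False using 0(3)[OF u(1) v] \<sigma>(2)[of u v] u(2) by auto
  qed
  then show ?case using partial_clan_singleton[of v] 0 \<sigma> by simp
next
  case (Suc i)
  \<comment> \<open>Chosen so that \<open>4 * L * \<Delta>\<close> is the previous scale and
    \<open>t * \<Delta>\<close> the new one: a hop distance above \<open>\<Delta>\<close> is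
    stretched to at least the new scale.\<close>
  define \<Delta> where "\<Delta> = \<sigma> * 2 ^ i / (4 * real L)"
  have \<Delta>: "4 * real L * \<Delta> = \<sigma> * 2 ^ i" "t * \<Delta> = \<sigma> * 2 ^ Suc i" "0 < \<Delta>"
    using L \<sigma> by (auto simp: \<Delta>_def)
  show ?case
  proof (rule partial_clan_step[of \<Delta>])
    show "ereal (4 * real L * \<Delta>) \<le> ereal (\<sigma> * 2 ^ Suc i)" unfolding \<Delta>(1) using \<sigma> by simp
    fix u v
    show "D h u v \<le> ereal \<Delta> \<or> ereal (\<sigma> * 2 ^ Suc i) \<le> ereal t * D h u v"
    proof (cases "D h u v \<le> ereal \<Delta>")
      case False
      then have "ereal t * ereal \<Delta> \<le> ereal t * D h u v" by (intro ereal_mult_left_mono) auto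
      then show ?thesis using \<Delta>(2) by simp
    qed simp
  qed (use Suc \<Delta> in \<open>auto simp: \<Delta>(1)\<close>)
qed

text \<open>Doubling starts below all \<open>H\<close>-hop distances. Once \<open>\<Delta>\<close>
  exceeds every finite \<open>h\<close>-hop distance, a last step reaches scale infinity, since
  \<open>D h u v\<close> is then at most \<open>\<Delta>\<close> or infinite. The number of scales
  enters no bound, so the aspect ratio is arbitrary.\<close>

theorem partial_clan_exists:
  assumes "V \<noteq> {}"
  shows "\<exists>c. partial_clan V \<infinity> c"
proof -
  define P where "P = {(u, v). u \<in> V \<and> v \<in> V \<and> u \<noteq> v}"
  have fP: "finite P" unfolding P_def by (rule finite_subset[of _ "V \<times> V"]) (use finite_V in auto)
  have "\<exists>\<sigma>>0. \<forall>(u, v)\<in>Q. ereal \<sigma> < D H u v" if "finite Q" "Q \<subseteq> P" for Q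
    using that
  proof (induction Q rule: finite_induct)
    case (insert q Q)
    then obtain \<sigma> where \<sigma>: "0 < \<sigma>" "\<forall>(u, v)\<in>Q. ereal \<sigma> < D H u v" by auto
    obtain u v where q: "q = (u, v)" by force
    have "0 < D H u v" using insert.prems q by (auto simp: P_def intro: D_pos)
    then obtain r where r: "0 < ereal r" "ereal r < D H u v" using ereal_dense2 by blast
    have "ereal (min \<sigma> r) < D H u' v'" if "(u', v') \<in> insert q Q" for u' v'
    proof (cases "(u', v') = q")
      case True
      have "ereal (min \<sigma> r) \<le> ereal r" by simp
      also have "\<dots> < D H u' v'" using True q r by simp
      finally show ?thesis .
    next
      case False
      have "ereal (min \<sigma> r) \<le> ereal \<sigma>" by simp
      also have "\<dots> < D H u' v'" using False that \<sigma> by auto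
      finally show ?thesis .
    qed
    then show ?case using \<sigma> r by (intro exI[of _ "min \<sigma> r"]) auto
  qed (auto intro: exI[of _ 1])
  from this[OF fP order_refl] obtain \<sigma> where
    \<sigma>: "0 < \<sigma>" "\<And>u v. u \<in> V \<Longrightarrow> v \<in> V \<Longrightarrow> u \<noteq> v \<Longrightarrow> ereal \<sigma> < D H u v"
    unfolding P_def by blast
  \<comment> \<open>A common bound of all finite \<open>h\<close>-hop distances;
    \<open>real_of_ereal\<close> sends infinity to 0, so infinite ones contribute nothing.\<close>
  define W where "W = (\<Sum>(u, v)\<in>V \<times> V. \<bar>real_of_ereal (D h u v)\<bar>)"
  have W: "D h u v \<le> ereal W" if "u \<in> V" "v \<in> V" "D h u v \<noteq> \<infinity>" for u v
  proof -
    have "(case (u, v) of (u, v) \<Rightarrow> \<bar>real_of_ereal (D h u v)\<bar>) \<le> W" unfolding W_def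
      by (rule member_le_sum) (use that finite_V in \<open>auto intro!: real_of_ereal_pos\<close>)
    then show ?thesis using that D_nonneg[of u v h] by (cases "D h u v") auto
  qed
  obtain N where N: "4 * real L * W / \<sigma> < 2 ^ N" using real_arch_pow[of 2 "4 * real L * W / \<sigma>"] by auto
  define \<Delta> where "\<Delta> = \<sigma> * 2 ^ N / (4 * real L)"
  have \<Delta>: "4 * real L * \<Delta> = \<sigma> * 2 ^ N" "0 < \<Delta>" using L \<sigma> by (auto simp: \<Delta>_def)
  have "W \<le> \<Delta>" using N L \<sigma> by (simp add: \<Delta>_def field_simps)
  show ?thesis
  proof (rule partial_clan_step[of \<Delta>])
    fix u v assume uv: "u \<in> V" "v \<in> V"
    show "D h u v \<le> ereal \<Delta> \<or> \<infinity> \<le> ereal t * D h u v"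
    proof (cases "D h u v = \<infinity>")
      case True
      then show ?thesis using L by simp
    next
      case False
      then have "D h u v \<le> ereal W" using W uv by blast
      also have "\<dots> \<le> ereal \<Delta>" using \<open>W \<le> \<Delta>\<close> by simp
      finally show ?thesis by simp
    qed
  qed (use assms \<Delta> partial_clan_scale[OF \<sigma>] in \<open>auto simp: \<Delta>(1)\<close>)
qed

end

section \<open>Averaging over the embeddings\<close>

text \<open>Weights grow exponentially with accumulated cost, so \<open>opt\<close> answers with an
  element that is cheap where the cost was high so far. The sum of the weights grows by a bounded
  factor per round, and it dominates the weight of each single vertex. The sequence
  \<open>cs\<close> is later read as a uniform distribution.\<close>

lemma multiplicative_weights:
  fixes cost :: "'c \<Rightarrow> 'a \<Rightarrow> real"
  assumes V: "finite V" "V \<noteq> {}"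
    and cost: "\<And>c v. c \<in> S \<Longrightarrow> v \<in> V \<Longrightarrow> 0 \<le> cost c v \<and> cost c v \<le> M"
    and opt: "\<And>q. (\<And>v. v \<in> V \<Longrightarrow> 0 < q v) \<Longrightarrow> \<exists>c\<in>S. (\<Sum>v\<in>V. q v * cost c v) \<le> B * sum q V"
    and \<delta>: "0 < \<delta>" and M: "1 \<le> M"
  shows "\<exists>T>0. \<exists>cs. (\<forall>i<T. cs i \<in> S) \<and> (\<forall>v\<in>V. (\<Sum>i<T. cost (cs i) v) \<le> real T * (B + \<delta>))"
proof -
  \<comment> \<open>\<open>1 / M\<close> keeps the exponents in the range of
    \<open>exp_bound\<close>; the other term limits the quadratic error to half of
    \<open>\<delta>\<close>.\<close>
  define \<eta> where "\<eta> = min (1 / M) (\<delta> / (2 * M\<^sup>2))"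
  have \<eta>: "0 < \<eta>" "\<eta> * M \<le> 1" "\<eta> * M\<^sup>2 \<le> \<delta> / 2"
  proof -
    show "0 < \<eta>" using M \<delta> by (simp add: \<eta>_def)
    have "\<eta> * M \<le> 1 / M * M" using M by (intro mult_right_mono) (auto simp: \<eta>_def)
    then show "\<eta> * M \<le> 1" using M by simp
    have "\<eta> * M\<^sup>2 \<le> \<delta> / (2 * M\<^sup>2) * M\<^sup>2" by (intro mult_right_mono) (auto simp: \<eta>_def)
    then show "\<eta> * M\<^sup>2 \<le> \<delta> / 2" using M by simp
  qed
  define r where "r = \<eta> * B + \<eta>\<^sup>2 * M\<^sup>2"
  have potential: "\<exists>cs. (\<forall>i<T. cs i \<in> S) \<and>
      (\<Sum>v\<in>V. exp (\<eta> * (\<Sum>i<T. cost (cs i) v))) \<le> real (card V) * exp (real T * r)" for T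
  proof (induction T)
    case (Suc T)
    then obtain cs where cs: "\<forall>i<T. cs i \<in> S"
      "(\<Sum>v\<in>V. exp (\<eta> * (\<Sum>i<T. cost (cs i) v))) \<le> real (card V) * exp (real T * r)" by blast
    define q where "q v = exp (\<eta> * (\<Sum>i<T. cost (cs i) v))" for v
    obtain c where c: "c \<in> S" "(\<Sum>v\<in>V. q v * cost c v) \<le> B * sum q V"
      using opt[of q] by (auto simp: q_def)
    define cs' where "cs' = cs(T := c)"
    have "(\<Sum>v\<in>V. exp (\<eta> * (\<Sum>i<Suc T. cost (cs' i) v))) = (\<Sum>v\<in>V. q v * exp (\<eta> * cost c v))"
      by (intro sum.cong refl) (simp add: q_def cs'_def distrib_left exp_add)
    also have "\<dots> \<le> (\<Sum>v\<in>V. q v * (1 + \<eta> * cost c v + \<eta>\<^sup>2 * M\<^sup>2))"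
    proof (intro sum_mono mult_left_mono)
      fix v assume v: "v \<in> V"
      have b: "0 \<le> cost c v" "cost c v \<le> M" using cost c v by blast+
      have "\<eta> * cost c v \<le> \<eta> * M" using b \<eta> by (intro mult_left_mono) auto
      then have "exp (\<eta> * cost c v) \<le> 1 + \<eta> * cost c v + (\<eta> * cost c v)\<^sup>2"
        using b \<eta> by (intro exp_bound order_trans[OF _ \<eta>(2)]) auto
      also have "(\<eta> * cost c v)\<^sup>2 \<le> (\<eta> * M)\<^sup>2"
        using \<open>\<eta> * cost c v \<le> \<eta> * M\<close> b \<eta> by (intro power_mono) auto
      finally show "exp (\<eta> * cost c v) \<le> 1 + \<eta> * cost c v + \<eta>\<^sup>2 * M\<^sup>2"
        by (simp add: power_mult_distrib)
    qed (simp add: q_def)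
    also have "\<dots> = sum q V + \<eta> * (\<Sum>v\<in>V. q v * cost c v) + \<eta>\<^sup>2 * M\<^sup>2 * sum q V"
      by (simp add: sum.distrib sum_distrib_left sum_distrib_right algebra_simps)
    also have "\<dots> \<le> sum q V + \<eta> * (B * sum q V) + \<eta>\<^sup>2 * M\<^sup>2 * sum q V"
      using c \<eta> by (intro add_mono mult_left_mono) auto
    also have "\<dots> = (1 + r) * sum q V" by (simp add: r_def algebra_simps)
    also have "\<dots> \<le> exp r * sum q V"
      by (intro mult_right_mono exp_ge_add_one_self sum_nonneg) (simp add: q_def)
    also have "\<dots> \<le> exp r * (real (card V) * exp (real T * r))"
      using cs(2) by (intro mult_left_mono) (auto simp: q_def)
    also have "\<dots> = real (card V) * exp (real (Suc T) * r)"
      by (simp add: exp_add distrib_right)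
    finally have "(\<Sum>v\<in>V. exp (\<eta> * (\<Sum>i<Suc T. cost (cs' i) v))) \<le> real (card V) * exp (real (Suc T) * r)" .
    moreover have "\<forall>i<Suc T. cs' i \<in> S" using cs(1) c(1) by (auto simp: cs'_def less_Suc_eq)
    ultimately show ?case by blast
  qed simp
  have card: "0 < real (card V)" using V by (simp add: card_gt_0_iff)
  \<comment> \<open>After this many rounds the logarithm of the initial potential
    \<open>card V\<close> costs at most the other half of \<open>\<delta>\<close> on
    average.\<close>
  obtain T where T: "2 * ln (real (card V)) / (\<eta> * \<delta>) < real T" using reals_Archimedean2 by blast
  define T' where "T' = Suc T"
  have T': "ln (real (card V)) \<le> real T' * (\<eta> * (\<delta> / 2))"
  proof -
    have "2 * ln (real (card V)) / (\<eta> * \<delta>) \<le> real T'" using T by (simp add: T'_def)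
    then show ?thesis using \<eta> \<delta> by (simp add: field_simps)
  qed
  obtain cs where cs: "\<forall>i<T'. cs i \<in> S"
    "(\<Sum>v\<in>V. exp (\<eta> * (\<Sum>i<T'. cost (cs i) v))) \<le> real (card V) * exp (real T' * r)"
    using potential by blast
  have "(\<Sum>i<T'. cost (cs i) v) \<le> real T' * (B + \<delta>)" if v: "v \<in> V" for v
  proof -
    have "exp (\<eta> * (\<Sum>i<T'. cost (cs i) v)) \<le> (\<Sum>v\<in>V. exp (\<eta> * (\<Sum>i<T'. cost (cs i) v)))"
      using v V by (intro member_le_sum) auto
    also have "\<dots> \<le> exp (ln (real (card V)) + real T' * r)" using cs(2) card by (simp add: exp_add)
    finally have "\<eta> * (\<Sum>i<T'. cost (cs i) v) \<le> ln (real (card V)) + real T' * r" by simp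
    also have "\<dots> \<le> real T' * (\<eta> * (\<delta> / 2)) + real T' * (\<eta> * B + \<eta> * (\<delta> / 2))"
    proof (intro add_mono T' mult_left_mono)
      have "\<eta> * (\<eta> * M\<^sup>2) \<le> \<eta> * (\<delta> / 2)" using \<eta> by (intro mult_left_mono) auto
      then show "r \<le> \<eta> * B + \<eta> * (\<delta> / 2)" by (simp add: r_def power2_eq_square mult.assoc)
    qed simp
    also have "\<dots> = \<eta> * (real T' * (B + \<delta>))" by (simp add: algebra_simps)
    finally show ?thesis using \<eta> by (simp add: mult_le_cancel_left_pos)
  qed
  then show ?thesis using cs(1) by (intro exI[of _ T']) (auto simp: T'_def)
qed

lemma expected_copies_uniform:
  assumes T: "0 < T" and fin: "\<And>i. i < T \<Longrightarrow> finite (copies (cs i) v)"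
  shows "expected_copies (map_pmf cs (pmf_of_set {..<T})) v
    = ennreal ((\<Sum>i<T. real (card (copies (cs i) v))) / real T)"
proof -
  have "expected_copies (map_pmf cs (pmf_of_set {..<T})) v
      = (\<Sum>i<T. emeasure (count_space UNIV) (copies (cs i) v)) / ennreal (real T)"
    unfolding expected_copies_def using T
    by (simp add: nn_integral_pmf_of_set lessThan_empty_iff ennreal_of_nat_eq_real_of_nat)
  also have "(\<Sum>i<T. emeasure (count_space UNIV) (copies (cs i) v))
      = (\<Sum>i<T. ennreal (real (card (copies (cs i) v))))"
    using fin by (intro sum.cong) (auto simp: emeasure_count_space_finite ennreal_of_nat_eq_real_of_nat)
  also have "\<dots> = ennreal (\<Sum>i<T. real (card (copies (cs i) v)))" by (intro sum_ennreal) auto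
  finally show ?thesis using T by (simp add: divide_ennreal sum_nonneg)
qed

context hop_metric
begin

text \<open>The weights differ between members, but their common total mass lets one growth
  condition and one logarithm serve for all.\<close>

definition clans :: "nat \<Rightarrow> nat \<Rightarrow> nat \<Rightarrow> ('a, nat) clan set" where
  "clans h L k = {c. \<exists>\<mu>. clan_construction V D L k \<mu> \<and> sum \<mu> V = 2 * real (card V) \<and>
     clan_construction.partial_clan D h L k \<mu> V \<infinity> c}"

text \<open>Any \<open>q\<close> is rescaled to total mass \<open>n\<close> and added to 1. The
  weighted count of copies is at most \<open>2 * n * R\<close>; removing the at least
  \<open>n\<close> copies counted by the constant part and dividing by \<open>n\<close> leaves the
  average \<open>2 * R - 1\<close>.\<close>

lemma clan_distribution:
  assumes V: "V \<noteq> {}" and L: "1 \<le> L" and k: "1 \<le> k"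
    and growth: "ln (2 * real (card V)) \<le> ln 2 * (1 + 1 / real k) ^ L" and \<delta>: "0 < \<delta>"
  shows "\<exists>P :: ('a, nat) clan pmf. set_pmf P \<subseteq> clans h L k \<and>
    (\<forall>v\<in>V. expected_copies P v \<le> ennreal (2 * (2 * real (card V)) powr (1 / real k) - 1 + \<delta>))"
proof -
  define n where "n = real (card V)"
  define R where "R = (2 * n) powr (1 / real k)"
  have n: "1 \<le> n" using V finite_V by (simp add: n_def Suc_le_eq card_gt_0_iff)
  \<comment> \<open>The cost bound for \<open>multiplicative_weights\<close>: weights are at least
    1, so no vertex has more copies than the weighted count.\<close>
  have cl: "(\<forall>v\<in>V. finite (copies c v) \<and> copies c v \<noteq> {} \<and> real (card (copies c v)) \<le> 2 * n * R)"
    if c: "c \<in> clans h L k" for c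
  proof -
    obtain \<mu> where \<mu>: "clan_construction V D L k \<mu>" "sum \<mu> V = 2 * n"
      "clan_construction.partial_clan D h L k \<mu> V \<infinity> c" using c by (auto simp: clans_def n_def)
    interpret clan_construction V D h L k \<mu> by fact
    note c = partial_clanD[OF \<mu>(3)]
    have "real (card (copies c v)) \<le> 2 * n * R" if v: "v \<in> V" for v
    proof -
      have "1 * real (card (copies c v)) \<le> \<mu> v * real (card (copies c v))"
        using \<mu>_ge_1[OF v] by (intro mult_right_mono) auto
      also have "\<dots> \<le> (\<Sum>v\<in>V. \<mu> v * real (card (copies c v)))"
        using v finite_V \<mu>_nonneg by (intro member_le_sum[where f = "\<lambda>v. \<mu> v * real (card (copies c v))"]) auto
      also have "\<dots> \<le> 2 * n * R" using c(8) n by (simp add: \<mu>(2) R_def powr_add)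
      finally show ?thesis by simp
    qed
    then show ?thesis using c(3) by blast
  qed
  have R1: "1 \<le> R" unfolding R_def using n by (intro ge_one_powr_ge_zero) auto
  have "\<exists>T>0. \<exists>cs. (\<forall>i<T. cs i \<in> clans h L k) \<and>
      (\<forall>v\<in>V. (\<Sum>i<T. real (card (copies (cs i) v))) \<le> real T * ((2 * R - 1) + \<delta>))"
  proof (rule multiplicative_weights[OF finite_V V, where M = "2 * n * R"])
    fix q :: "'a \<Rightarrow> real" assume q: "\<And>v. v \<in> V \<Longrightarrow> 0 < q v"
    have Q: "0 < sum q V" using q V finite_V by (intro sum_pos) auto
    \<comment> \<open>The constant part of \<open>\<mu>\<close> keeps the total mass polynomial in \<open>n\<close> and already accounts for
      one copy of every vertex; this is what makes a bound close to 1 possible.\<close>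
    define \<mu> where "\<mu> v = 1 + n * q v / sum q V" for v
    have tot: "sum \<mu> V = 2 * n"
      using Q by (simp add: \<mu>_def sum.distrib n_def flip: sum_divide_distrib sum_distrib_left)
    interpret clan_construction V D h L k \<mu>
    proof
      show "1 \<le> \<mu> v" if "v \<in> V" for v using q[OF that] Q n by (simp add: \<mu>_def)
      show "ln (sum \<mu> V) \<le> ln 2 * (1 + 1 / real k) ^ L" using growth by (simp add: tot n_def)
    qed (use L k in auto)
    obtain c where c: "partial_clan V \<infinity> c" using partial_clan_exists[OF V] by blast
    have cS: "c \<in> clans h L k"
      unfolding clans_def using c tot clan_construction_axioms by (auto simp: n_def)
    have "n + n / sum q V * (\<Sum>v\<in>V. q v * real (card (copies c v)))
        \<le> (\<Sum>v\<in>V. real (card (copies c v))) + n / sum q V * (\<Sum>v\<in>V. q v * real (card (copies c v)))"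
    proof (intro add_right_mono)
      have "(\<Sum>v\<in>V. 1) \<le> (\<Sum>v\<in>V. real (card (copies c v)))"
        using cl[OF cS] by (intro sum_mono) (auto simp: Suc_le_eq card_gt_0_iff)
      then show "n \<le> (\<Sum>v\<in>V. real (card (copies c v)))" by (simp add: n_def)
    qed
    also have "\<dots> = (\<Sum>v\<in>V. \<mu> v * real (card (copies c v)))"
      by (simp add: \<mu>_def distrib_right sum.distrib sum_distrib_left mult.assoc)
    also have "\<dots> \<le> 2 * n * R" using partial_clanD(8)[OF c] n by (simp add: tot R_def powr_add)
    finally have "n * ((\<Sum>v\<in>V. q v * real (card (copies c v))) / sum q V) \<le> n * (2 * R - 1)"
      by (simp add: algebra_simps)
    then have "(\<Sum>v\<in>V. q v * real (card (copies c v))) / sum q V \<le> 2 * R - 1"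
      by (subst (asm) mult_le_cancel_left_pos) (use n in auto)
    then show "\<exists>c\<in>clans h L k. (\<Sum>v\<in>V. q v * real (card (copies c v))) \<le> (2 * R - 1) * sum q V"
      using cS Q by (auto simp: pos_divide_le_eq)
  next
    show "1 \<le> 2 * n * R" using n R1 mult_mono[of 1 "2 * n" 1 R] by simp
  qed (use cl \<delta> in auto)
  then obtain T cs where T: "0 < T" "\<forall>i<T. cs i \<in> clans h L k"
    "\<forall>v\<in>V. (\<Sum>i<T. real (card (copies (cs i) v))) \<le> real T * ((2 * R - 1) + \<delta>)" by blast
  let ?P = "map_pmf cs (pmf_of_set {..<T})"
  have "set_pmf ?P \<subseteq> clans h L k" using T(1,2) by (auto simp: lessThan_empty_iff)
  moreover have "expected_copies ?P v \<le> ennreal (2 * R - 1 + \<delta>)" if v: "v \<in> V" for v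
  proof -
    have "(\<Sum>i<T. real (card (copies (cs i) v))) / real T \<le> 2 * R - 1 + \<delta>"
      using T(1,3) v by (simp add: pos_divide_le_eq mult.commute)
    then show ?thesis
      using expected_copies_uniform[of T cs v] T(1,2) cl v by (simp add: ennreal_leI)
  qed
  ultimately show ?thesis unfolding R_def n_def by blast
qed

end

section \<open>Clan embeddings of weighted graphs\<close>

definition ball_steps :: "nat \<Rightarrow> nat \<Rightarrow> nat" where
  "ball_steps n k = nat \<lceil>6 * real k * loglog_factor n\<rceil>"

text \<open>Rounding up adds at most 1, and \<open>k * loglog_factor n\<close> is at least 1, so the
  last constant is \<open>8 * 6 + 8 = 56\<close>.\<close>

lemma ball_steps_bounds:
  assumes "1 \<le> k"
  shows "1 \<le> ball_steps n k" "6 * real k * loglog_factor n \<le> real (ball_steps n k)"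
    "8 * real (ball_steps n k) \<le> 56 * (real k * loglog_factor n)"
proof -
  have 1: "1 \<le> real k * loglog_factor n"
    using assms mult_mono[of 1 "real k" 1 "loglog_factor n"] by (simp add: loglog_factor_def)
  show 2: "6 * real k * loglog_factor n \<le> real (ball_steps n k)" unfolding ball_steps_def by linarith
  then show "1 \<le> ball_steps n k" using 1 by linarith
  show "8 * real (ball_steps n k) \<le> 56 * (real k * loglog_factor n)"
    using 1 unfolding ball_steps_def by linarith
qed

lemma ln_double_le: "1 \<le> n \<Longrightarrow> ln (2 * real n) \<le> 2 * log_factor n"
  using ln_2_less_1 by (simp add: ln_mult log_factor_def)

lemma log2_double_le: "1 \<le> n \<Longrightarrow> log 2 (2 * real n) \<le> 3 * log_factor n"
proof -
  assume n: "1 \<le> n"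
  have "ln (2 * real n) \<le> 2 * log_factor n" using ln_double_le[OF n] .
  also have "\<dots> \<le> 3 * log_factor n * ln 2"
    using mult_right_mono[of 2 "3 * ln 2" "log_factor n"] ln2_ge_two_thirds
    by (simp add: log_factor_def mult_ac)
  finally show ?thesis by (simp add: log_def pos_divide_le_eq)
qed

text \<open>By Bernoulli, \<open>(1 + 1 / k) ^ k \<ge> 2\<close>, so
  \<open>6 * k * loglog_factor n\<close> steps give at least
  \<open>exp (3 * loglog_factor n)\<close>, the cube of a bound on \<open>ln n\<close>. One factor
  covers \<open>ln n\<close>, the other two absorb constants.\<close>

lemma ball_steps_growth:
  assumes n: "1 \<le> n" and k: "1 \<le> k"
  shows "ln (2 * real n) \<le> ln 2 * (1 + 1 / real k) ^ ball_steps n k"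
proof -
  let ?e = "exp (loglog_factor n)"
  have "1 \<le> loglog_factor n" by (simp add: loglog_factor_def)
  then have e2: "2 \<le> ?e" using exp_ge_add_one_self[of "loglog_factor n"] by linarith
  have ln: "ln (real n) \<le> ?e"
  \<comment> \<open>For \<open>n = 1\<close> the inner logarithm is 0, so \<open>exp\<close> and
    \<open>ln\<close> do not cancel; the bound is trivial there.\<close>
  proof (cases "n = 1")
    case False
    then have "0 < ln (real n)" using n by simp
    then have "ln (real n) = exp (ln (ln (real n)))" by simp
    also have "\<dots> \<le> ?e" by (simp add: loglog_factor_def)
    finally show ?thesis .
  qed simp
  have "- 1 \<le> 1 / real k" by (rule order_trans[of _ 0]) auto
  then have "2 \<le> (1 + 1 / real k) ^ k"
    using Bernoulli_inequality[of "1 / real k" k] k by simp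
  then have "ln 2 \<le> ln ((1 + 1 / real k) ^ k)" by (intro ln_mono) auto
  also have "\<dots> = real k * ln (1 + 1 / real k)" by (rule ln_realpow)
  finally have lnk: "1 / 2 \<le> real k * ln (1 + 1 / real k)" using ln2_ge_two_thirds by linarith
  have "3 * loglog_factor n \<le> 6 * loglog_factor n * (real k * ln (1 + 1 / real k))"
    using mult_left_mono[OF lnk, of "6 * loglog_factor n"] by (simp add: loglog_factor_def)
  also have "\<dots> = 6 * real k * loglog_factor n * ln (1 + 1 / real k)" by simp
  also have "\<dots> \<le> real (ball_steps n k) * ln (1 + 1 / real k)"
    using ball_steps_bounds(2)[OF k] by (intro mult_right_mono) auto
  also have "\<dots> = ln ((1 + 1 / real k) ^ ball_steps n k)"
    by (rule ln_realpow[symmetric])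
  finally have "exp (3 * loglog_factor n) \<le> exp (ln ((1 + 1 / real k) ^ ball_steps n k))" by simp
  also have "\<dots> = (1 + 1 / real k) ^ ball_steps n k" by (intro exp_ln) (simp add: add_pos_nonneg)
  finally have pow: "?e ^ 3 \<le> (1 + 1 / real k) ^ ball_steps n k" by (simp flip: exp_of_nat_mult)
  have "ln (2 * real n) \<le> 1 + ?e" using n ln ln_2_less_1 by (simp add: ln_mult)
  also have "\<dots> \<le> 2 / 3 * (4 * ?e)" using e2 by simp
  also have "\<dots> \<le> 2 / 3 * (?e ^ 2 * ?e)"
    using e2 power_mono[of 2 ?e 2] by (intro mult_left_mono mult_right_mono) auto
  also have "\<dots> \<le> ln 2 * ?e ^ 3"
    using ln2_ge_two_thirds by (simp add: power2_eq_square power3_eq_cube)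
  also have "\<dots> \<le> ln 2 * (1 + 1 / real k) ^ ball_steps n k" using pow by (intro mult_left_mono) auto
  finally show ?thesis .
qed

section \<open>Walks and hop distances of a weighted graph\<close>

lemma pawalk_verts_0: "pcas u p v \<Longrightarrow> pawalk_verts u p ! 0 = u"
  by (cases p) auto

lemma length_pawalk_verts: "length (pawalk_verts u p) = Suc (length p)"
  by (induction p arbitrary: u) auto

lemma pcas_sublist:
  "pcas u p v \<Longrightarrow> i \<le> j \<Longrightarrow> j \<le> length p \<Longrightarrow>
    pcas (pawalk_verts u p ! i) (take (j - i) (drop i p)) (pawalk_verts u p ! j)"
proof (induction p arbitrary: u i j)
  case (Cons e es)
  then have es: "fst e = u" "pcas (snd e) es v" by auto
  show ?case
  proof (cases i)
    case 0
    then show ?thesis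
      using Cons.IH[OF es(2), of 0 "j - 1"] Cons.prems es pawalk_verts_0[OF es(2)] by (cases j) auto
  next
    case (Suc i')
    then show ?thesis using Cons.IH[OF es(2), of i' "j - 1"] Cons.prems by (cases j) auto
  qed
qed simp

context weighted_graph
begin

lemma awalk_cost_nonneg: "awalk u p v \<Longrightarrow> 0 \<le> awalk_cost w p"
  by (rule pos_cost_pos_awalk_cost) (auto intro: less_imp_le weight_pos)

lemma awalk_cost_rev_path: "set p \<subseteq> parcs G \<Longrightarrow> awalk_cost w (rev_path p) = awalk_cost w p"
  by (induction p) (auto dest: weight_sym)

lemma length_rev_path: "length (rev_path p) = length p"
  by (induction p) auto

lemma hop_dist_le: "awalk u p v \<Longrightarrow> length p \<le> h \<Longrightarrow> hop_dist G w h u v \<le> ereal (awalk_cost w p)"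
  unfolding hop_dist_def by (intro INF_lower) auto

lemma hop_dist_greatest:
  "(\<And>p. awalk u p v \<Longrightarrow> length p \<le> h \<Longrightarrow> r \<le> ereal (awalk_cost w p)) \<Longrightarrow> r \<le> hop_dist G w h u v"
  unfolding hop_dist_def by (intro INF_greatest) auto

lemma hop_dist_nonneg: "0 \<le> hop_dist G w h u v"
  by (rule hop_dist_greatest) (simp add: awalk_cost_nonneg)

lemma hop_dist_antimono: "a \<le> b \<Longrightarrow> hop_dist G w b u v \<le> hop_dist G w a u v"
  by (rule hop_dist_greatest) (simp add: hop_dist_le)

lemma hop_dist_sym_le: "hop_dist G w h u v \<le> hop_dist G w h v u"
proof (rule hop_dist_greatest)
  fix p assume p: "awalk v p u" "length p \<le> h"
  then have "hop_dist G w h u v \<le> ereal (awalk_cost w (rev_path p))"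
    by (intro hop_dist_le) (auto simp: length_rev_path)
  then show "hop_dist G w h u v \<le> ereal (awalk_cost w p)"
    using p awalk_cost_rev_path[of p] by (auto simp: awalk_def)
qed

text \<open>Two almost optimal walks are concatenated; working up to \<open>e\<close> avoids showing
  that the infima are attained.\<close>

lemma hop_dist_triangle: "hop_dist G w (a + b) u z \<le> hop_dist G w a u v + hop_dist G w b v z"
proof (cases "hop_dist G w a u v = \<infinity> \<or> hop_dist G w b v z = \<infinity>")
  case False
  then obtain r s where r: "hop_dist G w a u v = ereal r" and s: "hop_dist G w b v z = ereal s"
    using hop_dist_nonneg[of a u v] hop_dist_nonneg[of b v z]
    by (cases "hop_dist G w a u v"; cases "hop_dist G w b v z") auto
  have "hop_dist G w (a + b) u z \<le> ereal (r + s) + ereal e" if e: "0 < e" for e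
  proof -
    have "hop_dist G w a u v < ereal (r + e / 2)" "hop_dist G w b v z < ereal (s + e / 2)"
      using r s e by auto
    then obtain p q where p: "awalk u p v" "length p \<le> a" "awalk_cost w p < r + e / 2"
      and q: "awalk v q z" "length q \<le> b" "awalk_cost w q < s + e / 2"
      unfolding hop_dist_def INF_less_iff by auto
    have "hop_dist G w (a + b) u z \<le> ereal (awalk_cost w (p @ q))"
      using p q by (intro hop_dist_le awalk_appendI) auto
    also have "\<dots> \<le> ereal (r + s) + ereal e" using p q by simp
    finally show ?thesis .
  qed
  then show ?thesis using r s by (auto intro: ereal_le_epsilon2)
qed (use hop_dist_nonneg in auto)

text \<open>Distinct vertices need at least one arc, and the finitely many arcs have a smallest
  weight. The inserted 1 covers graphs without arcs.\<close>

lemma hop_dist_pos: "u \<noteq> v \<Longrightarrow> 0 < hop_dist G w h u v"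
proof -
  assume uv: "u \<noteq> v"
  define m where "m = Min (insert 1 (w ` parcs G))"
  have m: "0 < m" "\<And>e. e \<in> parcs G \<Longrightarrow> m \<le> w e"
    using finite_arcs weight_pos by (auto simp: m_def)
  have "ereal m \<le> hop_dist G w h u v"
  proof (rule hop_dist_greatest)
    fix p assume p: "awalk u p v"
    then obtain e es where es: "p = e # es" using uv by (cases p) (auto simp: awalk_Nil_iff)
    then have "awalk (snd e) es v" "e \<in> parcs G" using p by (auto simp: awalk_Cons_iff)
    then show "ereal m \<le> ereal (awalk_cost w p)"
      using awalk_cost_nonneg[of "snd e" es v] m(2)[of e] es by simp
  qed
  then show ?thesis using m(1) by (meson ereal_less(2) less_le_trans)
qed

lemma hop_metric_hop_dist: "hop_metric (pverts G) (hop_dist G w)"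
proof
  show "hop_dist G w h u u = 0" if "u \<in> pverts G" for u h
    using hop_dist_le[of u "[]" u h] hop_dist_nonneg[of h u u] that
    by (auto simp: awalk_Nil_iff zero_ereal_def intro: antisym)
qed (auto intro: hop_dist_pos hop_dist_triangle hop_dist_antimono antisym hop_dist_sym_le)

lemma graph_dist_le_hop_dist: "graph_dist G w u v \<le> hop_dist G w h u v"
  by (rule hop_dist_greatest) (rule min_cost_le_walk_cost)

sublocale hop_metric "pverts G" "hop_dist G w"
  by (rule hop_metric_hop_dist)

text \<open>The stretch between two positions is itself a walk in the subgraph formed by the path,
  so its cost bounds the distance there, which dominates the hop distance.\<close>

lemma hop_respecting_hop_path:
  assumes p: "awalk u p v" and resp: "hop_respecting G w h (walk_subgraph u p)"
  shows "hop_path h (\<lambda>i. pawalk_verts u p ! i) (\<lambda>i. w (p ! i)) 0 (length p)"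
  unfolding hop_path_def
proof (intro allI impI)
  fix i j :: nat assume ij: "i \<le> j" "j \<le> length p"
  let ?H = "walk_subgraph u p" and ?x = "\<lambda>i. pawalk_verts u p ! i" and ?q = "take (j - i) (drop i p)"
  interpret H: wf_digraph "with_proj ?H" using resp by (auto simp: hop_respecting_def)
  have xH: "?x l \<in> pverts ?H" if "l \<le> length p" for l
    using that by (auto simp: walk_subgraph_def length_pawalk_verts)
  have "set ?q \<subseteq> set p" by (meson order_trans set_drop_subset set_take_subset)
  then have "H.awalk (?x i) ?q (?x j)"
    using xH[of i] ij pcas_sublist[of u p v i j] p
    by (auto simp: pre_digraph.awalk_def walk_subgraph_def)
  then have "graph_dist ?H w (?x i) (?x j) \<le> ereal (awalk_cost w ?q)"
    by (rule H.min_cost_le_walk_cost)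
  also have "awalk_cost w ?q = (\<Sum>l\<in>{i..<j}. w (p ! l))"
    using ij sum.shift_bounds_nat_ivl[of "\<lambda>l. w (p ! l)" 0 i "j - i"]
    by (simp add: awalk_cost_def sum_list_sum_nth add.commute)
  finally show "hop_dist G w h (?x i) (?x j) \<le> ereal (\<Sum>l\<in>{i..<j}. w (p ! l))"
    using resp xH[of i] xH[of j] ij unfolding hop_respecting_def by (meson order_trans)
qed

section \<open>Transfer to the graph and choice of parameters\<close>

lemma clans_properties:
  assumes c: "c \<in> clans h L k" and n: "n = card (pverts G)" and t: "8 * real L \<le> t"
    and r: "8 * real L * log 2 (2 * real n) \<le> r"
  shows "ultrametric_clan_embedding G w c" "hop_distortion G w t t h c" "hop_path_distortion G w r h c"
proof -
  obtain \<mu> where \<mu>: "clan_construction (pverts G) (hop_dist G w) L k \<mu>" "sum \<mu> (pverts G) = 2 * real n"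
    "clan_construction.partial_clan (hop_dist G w) h L k \<mu> (pverts G) \<infinity> c"
    using c by (auto simp: clans_def n)
  interpret C: clan_construction "pverts G" "hop_dist G w" h L k \<mu> by fact
  note c = C.partial_clanD[OF \<mu>(3)]
  have dom: "hop_dist G w (4 * L * h) u v \<le> (INF p\<in>copies c u. INF q\<in>copies c v. pdist c p q)"
    if "u \<in> pverts G" "v \<in> pverts G" for u v
    using c(5) that by (intro INF_greatest) auto
  have "copies c v \<noteq> {} \<and> copies c v \<subseteq> points c \<and> chief c v \<in> copies c v" if "v \<in> pverts G" for v
    using c(3) that by blast
  then show "ultrametric_clan_embedding G w c"
    unfolding ultrametric_clan_embedding_def
    using c(1,4) order_trans[OF graph_dist_le_hop_dist dom] by blast
  show "hop_distortion G w t t h c"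
    unfolding hop_distortion_def
  proof (intro ballI conjI)
    fix u v assume uv: "u \<in> pverts G" "v \<in> pverts G"
    \<comment> \<open>The hop bound \<open>4 * L * h\<close> is an integer, so it survives the
      floor; \<open>t\<close> is dictated by the stretch \<open>8 * L\<close>.\<close>
    have "real (4 * L * h) \<le> t * real h"
      using t mult_right_mono[of "4 * real L" t "real h"] by simp
    then have "4 * L * h \<le> nat \<lfloor>t * real h\<rfloor>" by (simp add: le_nat_floor)
    then have "hop_dist G w (nat \<lfloor>t * real h\<rfloor>) u v \<le> hop_dist G w (4 * L * h) u v"
      by (rule hop_dist_antimono)
    also have "\<dots> \<le> hop_dist G w (4 * L * h) v u" by (rule hop_dist_sym_le)
    also have "\<dots> \<le> (INF p\<in>copies c v. INF q\<in>copies c u. pdist c p q)" using dom uv by blast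
    finally show "hop_dist G w (nat \<lfloor>t * real h\<rfloor>) u v
      \<le> (INF v'\<in>copies c v. INF u'\<in>copies c u. pdist c v' u')" .
    obtain p where p: "p \<in> copies c v" "pdist c p (chief c u) \<le> ereal (8 * real L) * hop_dist G w h u v"
      using c(6) uv by blast
    have "(INF v'\<in>copies c v. pdist c v' (chief c u)) \<le> pdist c p (chief c u)"
      using p(1) by (rule INF_lower)
    also note p(2)
    also have "ereal (8 * real L) * hop_dist G w h u v \<le> ereal t * hop_dist G w h u v"
      using t hop_dist_nonneg by (intro ereal_mult_right_mono) auto
    finally show "(INF v'\<in>copies c v. pdist c v' (chief c u)) \<le> ereal t * hop_dist G w h u v" .
  qed
  show "hop_path_distortion G w r h c"
    unfolding hop_path_distortion_def
  proof (intro allI impI, elim conjE)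
    fix u p v assume p: "awalk u p v" and resp: "hop_respecting G w h (walk_subgraph u p)"
    let ?x = "\<lambda>i. pawalk_verts u p ! i"
    have cost: "(\<Sum>i\<in>{0..<length p}. w (p ! i)) = awalk_cost w p"
      by (simp add: awalk_cost_def sum_list_sum_nth)
    have "set (pawalk_verts u p) \<subseteq> pverts G" using p by (elim awalkE)
    moreover have "?x ` {0..length p} \<subseteq> set (pawalk_verts u p)"
      by (intro image_subsetI nth_mem) (simp add: length_pawalk_verts)
    ultimately have "?x ` {0..length p} \<subseteq> pverts G" by simp
    then have "traced c ?x 0 (length p) (8 * real L * log 2 (2 * real n) * awalk_cost w p)"
      using c(7) hop_respecting_hop_path[OF p resp] by (simp add: \<mu>(2) flip: cost)
    then have "traced c ?x 0 (length p) (r * awalk_cost w p)"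
      using mult_right_mono[OF r awalk_cost_nonneg[OF p]] traced_mono by blast
    then show "\<exists>s. (\<forall>i\<le>length p. s i \<in> copies c (?x i)) \<and>
        (\<Sum>i<length p. pdist c (s i) (s (Suc i))) \<le> ereal (r * awalk_cost w p)"
      unfolding traced_def by (simp add: atLeast0LessThan Ball_def)
  qed
qed

text \<open>With \<open>ball_steps n k\<close> steps, the bound 56 on the stretch times the bound 3
  on the logarithm gives 168 for paths.\<close>

lemma clan_embedding_distribution:
  assumes n: "n = card (pverts G)" "1 \<le> n" and k: "1 \<le> k" and \<delta>: "0 < \<delta>"
    and t: "56 * (real k * loglog_factor n) \<le> t"
    and r: "168 * (real k * log_factor n * loglog_factor n) \<le> r"
    and x: "2 * (2 * real n) powr (1 / real k) - 1 + \<delta> \<le> x"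
  shows "\<exists>P :: ('a, nat) clan pmf. (\<forall>c\<in>set_pmf P. ultrametric_clan_embedding G w c \<and>
      hop_distortion G w t t h c \<and> hop_path_distortion G w r h c) \<and>
    (\<forall>v\<in>pverts G. expected_copies P v \<le> ennreal x)"
proof -
  define L where "L = ball_steps n k"
  note L = ball_steps_bounds[OF k, of n, folded L_def]
  have "8 * real L * log 2 (2 * real n) \<le> 56 * (real k * loglog_factor n) * (3 * log_factor n)"
    by (rule mult_mono) (use L(3) log2_double_le[OF n(2)] n(2) in \<open>auto simp: loglog_factor_def\<close>)
  then have r': "8 * real L * log 2 (2 * real n) \<le> r" using r by (simp add: mult_ac)
  have "pverts G \<noteq> {}" using n by auto
  from clan_distribution[OF this L(1) k _ \<delta>, of h] obtain P where
    P: "set_pmf P \<subseteq> clans h L k"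
      "\<forall>v\<in>pverts G. expected_copies P v \<le> ennreal (2 * (2 * real n) powr (1 / real k) - 1 + \<delta>)"
    using ball_steps_growth[OF n(2) k] unfolding L_def n(1) by blast
  have "expected_copies P v \<le> ennreal x" if "v \<in> pverts G" for v
    using P(2) that ennreal_leI[OF x] by (meson order_trans)
  moreover have "8 * real L \<le> t" using L(3) t by linarith
  ultimately show ?thesis using P(1) clans_properties[OF _ n(1) _ r'] by blast
qed

end

theorem theorem4:
  shows "\<exists>C::real. C > 0 \<and>
    (\<forall>(G :: 'a pair_pre_digraph) (w :: ('a \<times> 'a) weight_fun) (n::nat) (h::nat).
      weighted_graph G w \<and> n = card (pverts G) \<and> h \<in> {1..n} \<longrightarrow>
      (\<forall>k::nat. k \<in> {1..n} \<longrightarrow>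
        (\<exists>D :: ('a, nat) clan pmf.
          (\<forall>c \<in> set_pmf D.
            ultrametric_clan_embedding G w c \<and>
            hop_distortion G w (C * (real k * loglog_factor n)) (C * (real k * loglog_factor n)) h c \<and>
            hop_path_distortion G w (C * (real k * log_factor n * loglog_factor n)) h c) \<and>
          (\<forall>v \<in> pverts G. expected_copies D v \<le> ennreal (C * real n powr (1 / real k))))) \<and>
      (\<forall>\<epsilon>::real. 0 < \<epsilon> \<and> \<epsilon> < 1 \<longrightarrow>
        (\<exists>D :: ('a, nat) clan pmf.
          (\<forall>c \<in> set_pmf D.
            ultrametric_clan_embedding G w c \<and>
            hop_distortion G w (C * (log_factor n * loglog_factor n / \<epsilon>))
              (C * (log_factor n * loglog_factor n / \<epsilon>)) h c \<and>
            hop_path_distortion G w (C * ((log_factor n)\<^sup>2 * loglog_factor n / \<epsilon>)) h c) \<and>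
          (\<forall>v \<in> pverts G. expected_copies D v \<le> ennreal (1 + \<epsilon>)))))"
proof (intro exI[of _ "2000 :: real"] conjI allI impI)
  fix G :: "'a pair_pre_digraph" and w n h
  assume G: "weighted_graph G w \<and> n = card (pverts G) \<and> h \<in> {1..n}"
  interpret weighted_graph G w using G by blast
  have n: "n = card (pverts G)" "1 \<le> n" using G by auto
  have lf: "1 \<le> log_factor n" "1 \<le> loglog_factor n" by (auto simp: log_factor_def loglog_factor_def)
  {
    fix k :: nat assume "k \<in> {1..n}"
    then have k: "1 \<le> k" by simp
    have two: "(2 :: real) powr (1 / real k) \<le> 2" using k powr_mono[of "1 / real k" 1 2] by simp
    \<comment> \<open>With \<open>\<delta> = 1\<close> the term \<open>- 1\<close> cancels, and the
      left side is at most \<open>4 * n powr (1 / k)\<close>.\<close>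
    have "2 * (2 * real n) powr (1 / real k) - 1 + 1 \<le> 2000 * real n powr (1 / real k)"
      using mult_right_mono[OF two, of "real n powr (1 / real k)"] powr_ge_zero[of "real n" "1 / real k"]
      unfolding powr_mult by linarith
    from clan_embedding_distribution[OF n k _ _ _ this]
    show "\<exists>D :: ('a, nat) clan pmf.
          (\<forall>c \<in> set_pmf D.
            ultrametric_clan_embedding G w c \<and>
            hop_distortion G w (2000 * (real k * loglog_factor n)) (2000 * (real k * loglog_factor n)) h c \<and>
            hop_path_distortion G w (2000 * (real k * log_factor n * loglog_factor n)) h c) \<and>
          (\<forall>v \<in> pverts G. expected_copies D v \<le> ennreal (2000 * real n powr (1 / real k)))"
      using lf by simp
  next
    fix \<epsilon> :: real assume \<epsilon>: "0 < \<epsilon> \<and> \<epsilon> < 1"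
    \<comment> \<open>This \<open>k\<close> makes \<open>(2 * n) powr (1 / k)\<close> at most
      \<open>exp (\<epsilon> / 4)\<close>.\<close>
    define k where "k = nat \<lceil>4 * ln (2 * real n) / \<epsilon>\<rceil>"
    have pos: "0 < ln (2 * real n)" using n by simp
    have k4: "4 * ln (2 * real n) / \<epsilon> \<le> real k" unfolding k_def by linarith
    moreover have "0 < 4 * ln (2 * real n) / \<epsilon>" using pos \<epsilon> by simp
    ultimately have k: "1 \<le> k" by linarith
    have "real k \<le> 4 * ln (2 * real n) / \<epsilon> + 1"
      using \<open>0 < 4 * ln (2 * real n) / \<epsilon>\<close> unfolding k_def by linarith
    also have "\<dots> \<le> 8 * log_factor n / \<epsilon> + log_factor n / \<epsilon>"
    proof (intro add_mono)
      show "4 * ln (2 * real n) / \<epsilon> \<le> 8 * log_factor n / \<epsilon>"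
        using ln_double_le[OF n(2)] \<epsilon> by (intro divide_right_mono) auto
      show "1 \<le> log_factor n / \<epsilon>" using lf \<epsilon> by (simp add: le_divide_eq)
    qed
    \<comment> \<open>8 comes from \<open>4 * ln (2 * n)\<close> and 1 from rounding; both
      \<open>56 * 9\<close> and \<open>168 * 9\<close> stay below 2000.\<close>
    finally have k9: "real k \<le> 9 * (log_factor n / \<epsilon>)" by simp
    have t: "56 * (real k * loglog_factor n) \<le> 2000 * (log_factor n * loglog_factor n / \<epsilon>)"
    proof -
      have "56 * (real k * loglog_factor n) \<le> 56 * (9 * (log_factor n / \<epsilon>) * loglog_factor n)"
        using k9 lf by (intro mult_left_mono mult_right_mono) auto
      also have "\<dots> \<le> 2000 * (log_factor n * loglog_factor n / \<epsilon>)"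
        using lf \<epsilon> by (auto intro!: divide_right_mono mult_right_mono)
      finally show ?thesis .
    qed
    have r: "168 * (real k * log_factor n * loglog_factor n)
        \<le> 2000 * ((log_factor n)\<^sup>2 * loglog_factor n / \<epsilon>)"
    proof -
      have "168 * (real k * log_factor n * loglog_factor n)
          \<le> 168 * (9 * (log_factor n / \<epsilon>) * log_factor n * loglog_factor n)"
        using k9 lf by (intro mult_left_mono mult_right_mono) auto
      also have "\<dots> \<le> 2000 * ((log_factor n)\<^sup>2 * loglog_factor n / \<epsilon>)"
        using lf \<epsilon> by (auto simp: power2_eq_square intro!: divide_right_mono mult_right_mono)
      finally show ?thesis .
    qed
    \<comment> \<open>The left side is at most
      \<open>1 + 2 * (\<epsilon> / 4 + \<epsilon> / 16) + \<epsilon> / 8\<close>, which is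
      \<open>1 + 3 * \<epsilon> / 4\<close>.\<close>
    have x: "2 * (2 * real n) powr (1 / real k) - 1 + \<epsilon> / 8 \<le> 1 + \<epsilon>"
    proof -
      have "ln (2 * real n) / real k \<le> \<epsilon> / 4" using k4 k \<epsilon> by (simp add: field_simps)
      then have "(2 * real n) powr (1 / real k) \<le> exp (\<epsilon> / 4)" using n by (simp add: powr_def)
      also have "\<dots> \<le> 1 + \<epsilon> / 4 + (\<epsilon> / 4)\<^sup>2" using \<epsilon> by (intro exp_bound) auto
      also have "(\<epsilon> / 4)\<^sup>2 \<le> \<epsilon> / 16" using \<epsilon> by (simp add: power2_eq_square)
      finally show ?thesis using \<epsilon> by simp
    qed
    from clan_embedding_distribution[OF n k _ t r x]
    show "\<exists>D :: ('a, nat) clan pmf.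
          (\<forall>c \<in> set_pmf D.
            ultrametric_clan_embedding G w c \<and>
            hop_distortion G w (2000 * (log_factor n * loglog_factor n / \<epsilon>))
              (2000 * (log_factor n * loglog_factor n / \<epsilon>)) h c \<and>
            hop_path_distortion G w (2000 * ((log_factor n)\<^sup>2 * loglog_factor n / \<epsilon>)) h c) \<and>
          (\<forall>v \<in> pverts G. expected_copies D v \<le> ennreal (1 + \<epsilon>))"
      using \<epsilon> by simp
  }
qed simp

end
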